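(* Let $\mathcal{M}$ be an object of $\mathcal{M}on_{\rm ini}$, $\mathcal{A}$ an abelian category, $F:\mathcal{M}\to\mathcal{A}$ a functor and $d\in\mathbb{N}$. Then $F$ belongs to $\mathcal{P}ol_d^{\rm fort}(\mathcal{M},\mathcal{A})$ if and only if the functor $cr_{d+1}(F):\mathcal{M}^{d+1}\to\mathcal{A}$ is zero.
   Context: $\mathcal{M}on_{\rm ini}$ is the category of small strict symmetric monoidal categories $(\mathcal{M},\oplus,0)$ whose unit $0$ is an initial object. For an object $x$ of $\mathcal{M}$, $\delta_x(F)$ is the cokernel of the map $F\to F(x\oplus-)$ induced by $0\to x$. Full subcategories $\mathcal{P}ol_n^{\rm fort}(\mathcal{M},\mathcal{A})$ of the category of functors $\mathcal{M}\to\mathcal{A}$ are defined inductively: $\{0\}$ for $n<0$; for $n\ge0$, the $F$ with $\delta_x(F)\in\mathcal{P}ol_{n-1}^{\rm fort}(\mathcal{M},\mathcal{A})$ for every object $x$. Crossed effects: for $m\in\mathbb{N}$ and objects $a_1,\dots,a_m$ of $\mathcal{M}$, $$cr_m(F)(a_1,\dots,a_m)=\mathrm{Coker}\Big(\bigoplus_{i=1}^m F\Big(\bigoplus_{j\ne i}a_j\Big)\to F\Big(\bigoplus_{j=1}^m a_j\Big)\Big),$$ where the components are induced by the canonical morphisms $\bigoplus_{j\neq i}a_j\to\bigoplus_j a_j$ (identity on $a_j$ for $j\ne i$, and the unique map $0\to a_i$). *)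

theory Defs
  imports Main "HOL-Library.FuncSet"
begin

section \<open>Categories\<close>

record ('o, 'a) cat =
  Obj :: "'o set"
  Arr :: "'a set"
  Dom :: "'a \<Rightarrow> 'o"
  Cod :: "'a \<Rightarrow> 'o"
  Idt :: "'o \<Rightarrow> 'a"
  Comp :: "'a \<Rightarrow> 'a \<Rightarrow> 'a"  (infixl "\<cdot>\<index>" 70)

definition Hom :: "('o, 'a, 'r) cat_scheme \<Rightarrow> 'o \<Rightarrow> 'o \<Rightarrow> 'a set" where
  "Hom C x y = {f \<in> Arr C. Dom C f = x \<and> Cod C f = y}"

text \<open>Objects and arrows are sets, so smallness is automatic; \<open>g \<cdot> f\<close> is only meaningful when
  the codomain of \<open>f\<close> is the domain of \<open>g\<close>.\<close>

locale category =
  fixes C :: "('o, 'a, 'r) cat_scheme" (structure)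
  assumes Dom_Obj: "f \<in> Arr C \<Longrightarrow> Dom C f \<in> Obj C"
    and Cod_Obj: "f \<in> Arr C \<Longrightarrow> Cod C f \<in> Obj C"
    and Idt_Hom: "x \<in> Obj C \<Longrightarrow> Idt C x \<in> Hom C x x"
    and Comp_Hom: "f \<in> Hom C x y \<Longrightarrow> g \<in> Hom C y z \<Longrightarrow> g \<cdot> f \<in> Hom C x z"
    and Comp_Idt_left: "f \<in> Hom C x y \<Longrightarrow> Idt C y \<cdot> f = f"
    and Comp_Idt_right: "f \<in> Hom C x y \<Longrightarrow> f \<cdot> Idt C x = f"
    and Comp_assoc: "f \<in> Hom C w x \<Longrightarrow> g \<in> Hom C x y \<Longrightarrow> h \<in> Hom C y z \<Longrightarrow>
      (h \<cdot> g) \<cdot> f = h \<cdot> (g \<cdot> f)"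

definition is_initial :: "('o, 'a, 'r) cat_scheme \<Rightarrow> 'o \<Rightarrow> bool" where
  "is_initial C z \<longleftrightarrow> z \<in> Obj C \<and> (\<forall>x\<in>Obj C. \<exists>!f. f \<in> Hom C z x)"

definition is_terminal :: "('o, 'a, 'r) cat_scheme \<Rightarrow> 'o \<Rightarrow> bool" where
  "is_terminal C z \<longleftrightarrow> z \<in> Obj C \<and> (\<forall>x\<in>Obj C. \<exists>!f. f \<in> Hom C x z)"

definition is_zero_object :: "('o, 'a, 'r) cat_scheme \<Rightarrow> 'o \<Rightarrow> bool" where
  "is_zero_object C z \<longleftrightarrow> is_initial C z \<and> is_terminal C z"

definition is_zero_arrow :: "('o, 'a, 'r) cat_scheme \<Rightarrow> 'a \<Rightarrow> bool" where
  "is_zero_arrow C f \<longleftrightarrow>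
     (\<exists>z g h. is_zero_object C z \<and> h \<in> Hom C (Dom C f) z \<and> g \<in> Hom C z (Cod C f) \<and> f = g \<cdot>\<^bsub>C\<^esub> h)"

definition is_mono :: "('o, 'a, 'r) cat_scheme \<Rightarrow> 'a \<Rightarrow> bool" where
  "is_mono C f \<longleftrightarrow> f \<in> Arr C \<and>
     (\<forall>w\<in>Obj C. \<forall>g\<in>Hom C w (Dom C f). \<forall>h\<in>Hom C w (Dom C f).
        f \<cdot>\<^bsub>C\<^esub> g = f \<cdot>\<^bsub>C\<^esub> h \<longrightarrow> g = h)"

definition is_epi :: "('o, 'a, 'r) cat_scheme \<Rightarrow> 'a \<Rightarrow> bool" where
  "is_epi C f \<longleftrightarrow> f \<in> Arr C \<and>
     (\<forall>w\<in>Obj C. \<forall>g\<in>Hom C (Cod C f) w. \<forall>h\<in>Hom C (Cod C f) w.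
        g \<cdot>\<^bsub>C\<^esub> f = h \<cdot>\<^bsub>C\<^esub> f \<longrightarrow> g = h)"

definition is_kernel :: "('o, 'a, 'r) cat_scheme \<Rightarrow> 'a \<Rightarrow> 'a \<Rightarrow> bool" where
  "is_kernel C f k \<longleftrightarrow>
     f \<in> Arr C \<and> k \<in> Arr C \<and> Cod C k = Dom C f \<and> is_zero_arrow C (f \<cdot>\<^bsub>C\<^esub> k) \<and>
     (\<forall>t\<in>Arr C. Cod C t = Dom C f \<longrightarrow> is_zero_arrow C (f \<cdot>\<^bsub>C\<^esub> t) \<longrightarrow>
        (\<exists>!u. u \<in> Hom C (Dom C t) (Dom C k) \<and> k \<cdot>\<^bsub>C\<^esub> u = t))"

definition is_cokernel :: "('o, 'a, 'r) cat_scheme \<Rightarrow> 'a \<Rightarrow> 'a \<Rightarrow> bool" where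
  "is_cokernel C f q \<longleftrightarrow>
     f \<in> Arr C \<and> q \<in> Arr C \<and> Dom C q = Cod C f \<and> is_zero_arrow C (q \<cdot>\<^bsub>C\<^esub> f) \<and>
     (\<forall>t\<in>Arr C. Dom C t = Cod C f \<longrightarrow> is_zero_arrow C (t \<cdot>\<^bsub>C\<^esub> f) \<longrightarrow>
        (\<exists>!u. u \<in> Hom C (Cod C q) (Cod C t) \<and> u \<cdot>\<^bsub>C\<^esub> q = t))"

definition is_product ::
    "('o, 'a, 'r) cat_scheme \<Rightarrow> 'i set \<Rightarrow> ('i \<Rightarrow> 'o) \<Rightarrow> 'o \<Rightarrow> ('i \<Rightarrow> 'a) \<Rightarrow> bool" where
  "is_product C I X P p \<longleftrightarrow>
     P \<in> Obj C \<and> (\<forall>i\<in>I. p i \<in> Hom C P (X i)) \<and>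
     (\<forall>T\<in>Obj C. \<forall>g. (\<forall>i\<in>I. g i \<in> Hom C T (X i)) \<longrightarrow>
        (\<exists>!h. h \<in> Hom C T P \<and> (\<forall>i\<in>I. p i \<cdot>\<^bsub>C\<^esub> h = g i)))"

definition is_coproduct ::
    "('o, 'a, 'r) cat_scheme \<Rightarrow> 'i set \<Rightarrow> ('i \<Rightarrow> 'o) \<Rightarrow> 'o \<Rightarrow> ('i \<Rightarrow> 'a) \<Rightarrow> bool" where
  "is_coproduct C I X S s \<longleftrightarrow>
     S \<in> Obj C \<and> (\<forall>i\<in>I. s i \<in> Hom C (X i) S) \<and>
     (\<forall>T\<in>Obj C. \<forall>g. (\<forall>i\<in>I. g i \<in> Hom C (X i) T) \<longrightarrow>
        (\<exists>!h. h \<in> Hom C S T \<and> (\<forall>i\<in>I. h \<cdot>\<^bsub>C\<^esub> s i = g i)))"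

text \<open>Freyd's form of the definition: the addition of parallel arrows is not extra data, since it is
  uniquely determined by the axioms below.\<close>

locale abelian_category = category +
  assumes zero_object_exists: "\<exists>z. is_zero_object C z"
    and binary_product_exists:
      "x \<in> Obj C \<Longrightarrow> y \<in> Obj C \<Longrightarrow> \<exists>P p. is_product C UNIV (\<lambda>b::bool. if b then x else y) P p"
    and binary_coproduct_exists:
      "x \<in> Obj C \<Longrightarrow> y \<in> Obj C \<Longrightarrow> \<exists>S s. is_coproduct C UNIV (\<lambda>b::bool. if b then x else y) S s"
    and kernel_exists: "f \<in> Arr C \<Longrightarrow> \<exists>k. is_kernel C f k"
    and cokernel_exists: "f \<in> Arr C \<Longrightarrow> \<exists>q. is_cokernel C f q"
    and mono_normal: "is_mono C f \<Longrightarrow> \<exists>g. is_kernel C g f"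
    and epi_normal: "is_epi C f \<Longrightarrow> \<exists>g. is_cokernel C g f"

text \<open>A choice of cokernel projection; the cokernel object is its codomain.\<close>

definition coker :: "('o, 'a, 'r) cat_scheme \<Rightarrow> 'a \<Rightarrow> 'a" where
  "coker C f = (SOME q. is_cokernel C f q)"

section \<open>Functors and functor categories\<close>

record ('o, 'a, 'p, 'b) ftor =
  fobj :: "'o \<Rightarrow> 'p"
  farr :: "'a \<Rightarrow> 'b"

record ('o, 'a, 'p, 'b) ntrans =
  nsrc :: "('o, 'a, 'p, 'b) ftor"
  ntgt :: "('o, 'a, 'p, 'b) ftor"
  ncmp :: "'o \<Rightarrow> 'b"

text \<open>The \<open>extensional\<close> clauses fix the values outside the carrier, so that equality in HOL of functors
  and of natural transformations is the mathematical equality.\<close>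

definition is_functor ::
    "('o, 'a, 'r) cat_scheme \<Rightarrow> ('p, 'b, 's) cat_scheme \<Rightarrow> ('o, 'a, 'p, 'b) ftor \<Rightarrow> bool" where
  "is_functor C D F \<longleftrightarrow>
     fobj F \<in> extensional (Obj C) \<and> farr F \<in> extensional (Arr C) \<and>
     (\<forall>x\<in>Obj C. fobj F x \<in> Obj D) \<and>
     (\<forall>f\<in>Arr C. farr F f \<in> Hom D (fobj F (Dom C f)) (fobj F (Cod C f))) \<and>
     (\<forall>x\<in>Obj C. farr F (Idt C x) = Idt D (fobj F x)) \<and>
     (\<forall>f\<in>Arr C. \<forall>g\<in>Arr C. Cod C f = Dom C g \<longrightarrow>
        farr F (g \<cdot>\<^bsub>C\<^esub> f) = farr F g \<cdot>\<^bsub>D\<^esub> farr F f)"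

definition is_ntrans ::
    "('o, 'a, 'r) cat_scheme \<Rightarrow> ('p, 'b, 's) cat_scheme \<Rightarrow> ('o, 'a, 'p, 'b) ntrans \<Rightarrow> bool" where
  "is_ntrans C D t \<longleftrightarrow>
     is_functor C D (nsrc t) \<and> is_functor C D (ntgt t) \<and> ncmp t \<in> extensional (Obj C) \<and>
     (\<forall>x\<in>Obj C. ncmp t x \<in> Hom D (fobj (nsrc t) x) (fobj (ntgt t) x)) \<and>
     (\<forall>f\<in>Arr C. ncmp t (Cod C f) \<cdot>\<^bsub>D\<^esub> farr (nsrc t) f = farr (ntgt t) f \<cdot>\<^bsub>D\<^esub> ncmp t (Dom C f))"

definition Fct ::
    "('o, 'a, 'r) cat_scheme \<Rightarrow> ('p, 'b, 's) cat_scheme \<Rightarrow>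
     (('o, 'a, 'p, 'b) ftor, ('o, 'a, 'p, 'b) ntrans) cat" where
  "Fct C D =
     \<lparr>Obj = {F. is_functor C D F},
      Arr = {t. is_ntrans C D t},
      Dom = nsrc,
      Cod = ntgt,
      Idt = (\<lambda>F. \<lparr>nsrc = F, ntgt = F, ncmp = (\<lambda>x\<in>Obj C. Idt D (fobj F x))\<rparr>),
      Comp = (\<lambda>t s. \<lparr>nsrc = nsrc s, ntgt = ntgt t, ncmp = (\<lambda>x\<in>Obj C. ncmp t x \<cdot>\<^bsub>D\<^esub> ncmp s x)\<rparr>)\<rparr>"

text \<open>The power \<open>C\<^sup>m\<close>, with \<open>m\<close>-tuples as lists of length \<open>m\<close>.\<close>

definition cat_power :: "('o, 'a, 'r) cat_scheme \<Rightarrow> nat \<Rightarrow> ('o list, 'a list) cat" where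
  "cat_power C m =
     \<lparr>Obj = {as. length as = m \<and> set as \<subseteq> Obj C},
      Arr = {fs. length fs = m \<and> set fs \<subseteq> Arr C},
      Dom = map (Dom C),
      Cod = map (Cod C),
      Idt = map (Idt C),
      Comp = map2 (Comp C)\<rparr>"

section \<open>Strict symmetric monoidal categories with initial unit\<close>

record ('o, 'a) smc = "('o, 'a) cat" +
  Unit :: "'o"  ("\<zero>\<index>")
  OSum :: "'o \<Rightarrow> 'o \<Rightarrow> 'o"  (infixr "\<oplus>\<index>" 65)
  ASum :: "'a \<Rightarrow> 'a \<Rightarrow> 'a"  (infixr "\<boxplus>\<index>" 65)
  Braid :: "'o \<Rightarrow> 'o \<Rightarrow> 'a"

text \<open>\<open>\<oplus>\<close> and \<open>\<boxplus>\<close> are the object and arrow parts of the monoidal product. Associativity and unit are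
  strict, whereas the symmetry \<open>Braid x y : x \<oplus> y \<rightarrow> y \<oplus> x\<close> need not be an identity.\<close>

locale strict_symmetric_monoidal = category M for M :: "('o, 'a, 'r) smc_scheme" (structure) +
  assumes Unit_Obj: "\<zero> \<in> Obj M"
    and OSum_Obj: "x \<in> Obj M \<Longrightarrow> y \<in> Obj M \<Longrightarrow> x \<oplus> y \<in> Obj M"
    and ASum_Hom: "f \<in> Hom M x x' \<Longrightarrow> g \<in> Hom M y y' \<Longrightarrow> f \<boxplus> g \<in> Hom M (x \<oplus> y) (x' \<oplus> y')"
    and ASum_Idt: "x \<in> Obj M \<Longrightarrow> y \<in> Obj M \<Longrightarrow> Idt M x \<boxplus> Idt M y = Idt M (x \<oplus> y)"
    and ASum_Comp: "f \<in> Hom M x x' \<Longrightarrow> f' \<in> Hom M x' x'' \<Longrightarrow>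
      g \<in> Hom M y y' \<Longrightarrow> g' \<in> Hom M y' y'' \<Longrightarrow>
      (f' \<cdot> f) \<boxplus> (g' \<cdot> g) = (f' \<boxplus> g') \<cdot> (f \<boxplus> g)"
    and OSum_assoc: "x \<in> Obj M \<Longrightarrow> y \<in> Obj M \<Longrightarrow> z \<in> Obj M \<Longrightarrow>
      (x \<oplus> y) \<oplus> z = x \<oplus> (y \<oplus> z)"
    and OSum_Unit_left: "x \<in> Obj M \<Longrightarrow> \<zero> \<oplus> x = x"
    and OSum_Unit_right: "x \<in> Obj M \<Longrightarrow> x \<oplus> \<zero> = x"
    and ASum_assoc: "f \<in> Arr M \<Longrightarrow> g \<in> Arr M \<Longrightarrow> h \<in> Arr M \<Longrightarrow>
      (f \<boxplus> g) \<boxplus> h = f \<boxplus> (g \<boxplus> h)"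
    and ASum_Unit_left: "f \<in> Arr M \<Longrightarrow> Idt M \<zero> \<boxplus> f = f"
    and ASum_Unit_right: "f \<in> Arr M \<Longrightarrow> f \<boxplus> Idt M \<zero> = f"
    and Braid_Hom: "x \<in> Obj M \<Longrightarrow> y \<in> Obj M \<Longrightarrow> Braid M x y \<in> Hom M (x \<oplus> y) (y \<oplus> x)"
    and Braid_natural: "f \<in> Hom M x x' \<Longrightarrow> g \<in> Hom M y y' \<Longrightarrow>
      Braid M x' y' \<cdot> (f \<boxplus> g) = (g \<boxplus> f) \<cdot> Braid M x y"
    and Braid_symmetric: "x \<in> Obj M \<Longrightarrow> y \<in> Obj M \<Longrightarrow>
      Braid M y x \<cdot> Braid M x y = Idt M (x \<oplus> y)"
    and Braid_hexagon: "x \<in> Obj M \<Longrightarrow> y \<in> Obj M \<Longrightarrow> z \<in> Obj M \<Longrightarrow>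
      Braid M x (y \<oplus> z) = (Idt M y \<boxplus> Braid M x z) \<cdot> (Braid M x y \<boxplus> Idt M z)"
    and Braid_Unit: "x \<in> Obj M \<Longrightarrow> Braid M x \<zero> = Idt M x"

locale mon_ini = strict_symmetric_monoidal +
  assumes Unit_initial: "is_initial M \<zero>"

definition init_arr :: "('o, 'a, 'r) smc_scheme \<Rightarrow> 'o \<Rightarrow> 'a" where
  "init_arr M x = (THE f. f \<in> Hom M \<zero>\<^bsub>M\<^esub> x)"

definition osum_list :: "('o, 'a, 'r) smc_scheme \<Rightarrow> 'o list \<Rightarrow> 'o" where
  "osum_list M as = foldr (OSum M) as \<zero>\<^bsub>M\<^esub>"

definition asum_list :: "('o, 'a, 'r) smc_scheme \<Rightarrow> 'a list \<Rightarrow> 'a" where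
  "asum_list M fs = foldr (ASum M) fs (Idt M \<zero>\<^bsub>M\<^esub>)"

section \<open>Strong polynomial functors\<close>

definition shift_ftor ::
    "('o, 'a, 'r) smc_scheme \<Rightarrow> 'o \<Rightarrow> ('o, 'a, 'p, 'b) ftor \<Rightarrow> ('o, 'a, 'p, 'b) ftor" where
  "shift_ftor M x F =
     \<lparr>fobj = (\<lambda>y\<in>Obj M. fobj F (x \<oplus>\<^bsub>M\<^esub> y)),
      farr = (\<lambda>f\<in>Arr M. farr F (Idt M x \<boxplus>\<^bsub>M\<^esub> f))\<rparr>"

text \<open>The transformation \<open>F \<rightarrow> F(x \<oplus> -)\<close>; its source is \<open>F\<close> because \<open>\<zero> \<oplus> y = y\<close> strictly.\<close>

definition shift_ntrans ::
    "('o, 'a, 'r) smc_scheme \<Rightarrow> 'o \<Rightarrow> ('o, 'a, 'p, 'b) ftor \<Rightarrow> ('o, 'a, 'p, 'b) ntrans" where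
  "shift_ntrans M x F =
     \<lparr>nsrc = F,
      ntgt = shift_ftor M x F,
      ncmp = (\<lambda>y\<in>Obj M. farr F (init_arr M x \<boxplus>\<^bsub>M\<^esub> Idt M y))\<rparr>"

definition delta ::
    "('o, 'a, 'r) smc_scheme \<Rightarrow> ('p, 'b, 's) cat_scheme \<Rightarrow> 'o \<Rightarrow>
     ('o, 'a, 'p, 'b) ftor \<Rightarrow> ('o, 'a, 'p, 'b) ftor" where
  "delta M A x F = Cod (Fct M A) (coker (Fct M A) (shift_ntrans M x F))"

text \<open>The class of objects of the full subcategory \<open>Pol\<^sub>n\<^sup>f\<^sup>o\<^sup>r\<^sup>t(M, A)\<close> of \<open>Fct M A\<close>. For \<open>n < 0\<close> this
  is closed under isomorphism, as zero functors are only unique up to isomorphism.\<close>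

function Pol_fort ::
    "('o, 'a, 'r) smc_scheme \<Rightarrow> ('p, 'b, 's) cat_scheme \<Rightarrow> int \<Rightarrow> ('o, 'a, 'p, 'b) ftor set" where
  "Pol_fort M A n =
     (if n < 0 then {F. is_zero_object (Fct M A) F}
      else {F \<in> Obj (Fct M A). \<forall>x\<in>Obj M. delta M A x F \<in> Pol_fort M A (n - 1)})"
  by pat_completeness auto
termination
  by (relation "measure (\<lambda>(M, A, n). nat (n + 1))") auto

declare Pol_fort.simps [simp del]

section \<open>Crossed effects\<close>

text \<open>Positions in a tuple are counted from 0, so the summands are indexed by \<open>i < length as\<close>.\<close>

definition omit :: "nat \<Rightarrow> 'o list \<Rightarrow> 'o list" where
  "omit i as = take i as @ drop (Suc i) as"

text \<open>The canonical arrow from \<open>osum_list M (omit i as)\<close> to \<open>osum_list M as\<close>: the unit in position \<open>i\<close> of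
  its source vanishes by strictness.\<close>

definition omit_arr :: "('o, 'a, 'r) smc_scheme \<Rightarrow> nat \<Rightarrow> 'o list \<Rightarrow> 'a" where
  "omit_arr M i as = asum_list M ((map (Idt M) as)[i := init_arr M (as ! i)])"

text \<open>A choice of direct sum of the \<open>F (osum_list M (omit i as))\<close>, with its injections.\<close>

definition cr_source ::
    "('o, 'a, 'r) smc_scheme \<Rightarrow> ('p, 'b, 's) cat_scheme \<Rightarrow> ('o, 'a, 'p, 'b) ftor \<Rightarrow>
     'o list \<Rightarrow> 'p \<times> (nat \<Rightarrow> 'b)" where
  "cr_source M A F as =
     (SOME (S, s). is_coproduct A {..<length as} (\<lambda>i. fobj F (osum_list M (omit i as))) S s)"

definition cr_map ::
    "('o, 'a, 'r) smc_scheme \<Rightarrow> ('p, 'b, 's) cat_scheme \<Rightarrow> ('o, 'a, 'p, 'b) ftor \<Rightarrow>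
     'o list \<Rightarrow> 'b" where
  "cr_map M A F as =
     (THE h. h \<in> Hom A (fst (cr_source M A F as)) (fobj F (osum_list M as)) \<and>
        (\<forall>i<length as. h \<cdot>\<^bsub>A\<^esub> snd (cr_source M A F as) i = farr F (omit_arr M i as)))"

definition cr_proj ::
    "('o, 'a, 'r) smc_scheme \<Rightarrow> ('p, 'b, 's) cat_scheme \<Rightarrow> ('o, 'a, 'p, 'b) ftor \<Rightarrow>
     'o list \<Rightarrow> 'b" where
  "cr_proj M A F as = coker A (cr_map M A F as)"

text \<open>On arrows, the crossed effect is the map induced on cokernels by \<open>F (f\<^sub>1 \<oplus> \<dots> \<oplus> f\<^sub>m)\<close>.\<close>

definition crossed_effect ::
    "('o, 'a, 'r) smc_scheme \<Rightarrow> ('p, 'b, 's) cat_scheme \<Rightarrow> nat \<Rightarrow> ('o, 'a, 'p, 'b) ftor \<Rightarrow>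
     ('o list, 'a list, 'p, 'b) ftor" where
  "crossed_effect M A m F =
     \<lparr>fobj = (\<lambda>as\<in>Obj (cat_power M m). Cod A (cr_proj M A F as)),
      farr = (\<lambda>fs\<in>Arr (cat_power M m).
        let p = cr_proj M A F (map (Dom M) fs); q = cr_proj M A F (map (Cod M) fs)
        in THE u. u \<in> Hom A (Cod A p) (Cod A q) \<and>
             u \<cdot>\<^bsub>A\<^esub> p = q \<cdot>\<^bsub>A\<^esub> farr F (asum_list M fs))\<rparr>"

end

theory Submission
  imports Defs
begin

text \<open>A cokernel of \<open>f\<close> is zero iff every \<open>t\<close> with \<open>t \<cdot> f\<close> zero is itself zero. So \<open>cr\<^sub>m(F)(as)\<close> is zero
  iff every arrow out of \<open>F(\<Oplus>as)\<close> killed by all the canonical maps is zero, a condition that mentions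
  neither direct sums nor additivity. Cokernels of functors being pointwise, this condition for
  \<open>\<delta>\<^sub>x(F)\<close> at \<open>as\<close> is the one for \<open>F\<close> at \<open>x # as\<close>, which gives the inductive step. The induction starts at
  \<open>d = 0\<close>: \<open>\<delta>\<^sub>x(F) = 0\<close> for all \<open>x\<close> amounts to \<open>cr\<^sub>1(F) = 0\<close>, because \<open>0 \<rightarrow> x \<oplus> y\<close> factors through
  \<open>y \<rightarrow> x \<oplus> y\<close>.\<close>

section \<open>Zero arrows and cokernels\<close>

text \<open>The abelian category comes in Freyd's form, with no addition of arrows to compute with,
  so everything is reduced to whether an arrow is zero, and the uniqueness clauses of universal
  properties replace subtraction. Two choices then have to be controlled. \<open>delta\<close> takes
  an arbitrary cokernel in \<open>Fct M A\<close>, where even the existence of cokernels must be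
  proved: a pointwise cokernel is built by hand, and the chosen one is compared with it by an
  isomorphism. \<open>crossed_effect\<close> acts on arrows by a definite description, and being a
  zero object of a functor category includes being a functor; functoriality is derived from the
  vanishing of the values. The induction cannot start one step lower: the crossed effect of order 0
  is the value of \<open>F\<close> at \<open>\<zero>\<close>, and its vanishing does not force
  \<open>F\<close> to vanish, whereas degree -1 contains only zero functors.\<close>

lemma is_zero_object_Obj: "is_zero_object C z \<Longrightarrow> z \<in> Obj C"
  by (simp add: is_zero_object_def is_initial_def)

lemma zero_object_from_ex1: "is_zero_object C z \<Longrightarrow> x \<in> Obj C \<Longrightarrow> \<exists>!f. f \<in> Hom C z x"
  by (simp add: is_zero_object_def is_initial_def)

lemma zero_object_to_ex1: "is_zero_object C z \<Longrightarrow> x \<in> Obj C \<Longrightarrow> \<exists>!f. f \<in> Hom C x z"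
  by (simp add: is_zero_object_def is_terminal_def)

lemma HomI: "f \<in> Arr C \<Longrightarrow> Dom C f = x \<Longrightarrow> Cod C f = y \<Longrightarrow> f \<in> Hom C x y"
  by (simp add: Hom_def)

lemma HomD:
  assumes "f \<in> Hom C x y"
  shows Hom_Arr: "f \<in> Arr C" and Hom_Dom: "Dom C f = x" and Hom_Cod: "Cod C f = y"
  using assms by (simp_all add: Hom_def)

context category
begin

lemma Hom_Obj:
  assumes "f \<in> Hom C x y"
  shows "x \<in> Obj C" and "y \<in> Obj C"
  using assms Dom_Obj Cod_Obj by (auto simp: Hom_def)

lemma zero_arrowI:
  "is_zero_object C z \<Longrightarrow> h \<in> Hom C x z \<Longrightarrow> g \<in> Hom C z y \<Longrightarrow> is_zero_arrow C (g \<cdot> h)"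
  using Comp_Hom[of h x z g y] unfolding is_zero_arrow_def by (metis Hom_Cod Hom_Dom)

lemma zero_arrowE:
  assumes "is_zero_arrow C f" "f \<in> Hom C x y"
  obtains z g h where "is_zero_object C z" "h \<in> Hom C x z" "g \<in> Hom C z y" "f = g \<cdot> h"
  using assms unfolding is_zero_arrow_def by (metis Hom_Cod Hom_Dom)

text \<open>The two arrows may factor through different zero objects. An arrow \<open>e\<close>
  between these, unique at either end, turns one factorization into the other.\<close>

lemma zero_arrow_unique:
  assumes f: "is_zero_arrow C f" "f \<in> Hom C x y" and g: "is_zero_arrow C g" "g \<in> Hom C x y"
  shows "f = g"
proof -
  obtain z a b where z: "is_zero_object C z" "b \<in> Hom C x z" "a \<in> Hom C z y" "f = a \<cdot> b"
    using f by (rule zero_arrowE)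
  obtain w c d where w: "is_zero_object C w" "d \<in> Hom C x w" "c \<in> Hom C w y" "g = c \<cdot> d"
    using g by (rule zero_arrowE)
  obtain e where e: "e \<in> Hom C z w"
    using z(1) w(1) by (meson is_zero_object_Obj zero_object_from_ex1)
  have "e \<cdot> b = d"
    using zero_object_to_ex1[OF w(1) Hom_Obj(1)[OF z(2)]] Comp_Hom[OF z(2) e] w(2) by blast
  moreover have "c \<cdot> e = a"
    using zero_object_from_ex1[OF z(1) Hom_Obj(2)[OF z(3)]] Comp_Hom[OF e w(3)] z(3) by blast
  ultimately show ?thesis
    using z(4) w(4) Comp_assoc[OF z(2) e w(3)] by simp
qed

lemma zero_arrow_comp_left:
  assumes "is_zero_arrow C f" "f \<in> Hom C x y" "g \<in> Hom C y w"
  shows "is_zero_arrow C (g \<cdot> f)"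
proof -
  obtain z a b where z: "is_zero_object C z" "b \<in> Hom C x z" "a \<in> Hom C z y" "f = a \<cdot> b"
    using assms(1,2) by (rule zero_arrowE)
  show ?thesis
    using zero_arrowI[OF z(1,2) Comp_Hom[OF z(3) assms(3)]] Comp_assoc[OF z(2,3) assms(3)] z(4)
    by simp
qed

lemma zero_arrow_comp_right:
  assumes "is_zero_arrow C g" "g \<in> Hom C y w" "f \<in> Hom C x y"
  shows "is_zero_arrow C (g \<cdot> f)"
proof -
  obtain z a b where z: "is_zero_object C z" "b \<in> Hom C y z" "a \<in> Hom C z w" "g = a \<cdot> b"
    using assms(1,2) by (rule zero_arrowE)
  show ?thesis
    using zero_arrowI[OF z(1) Comp_Hom[OF assms(3) z(2)] z(3)] Comp_assoc[OF assms(3) z(2,3)] z(4)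
    by simp
qed

lemma zero_arrow_from_zero_object:
  assumes "is_zero_object C z" "f \<in> Hom C z y"
  shows "is_zero_arrow C f"
  using zero_arrowI[OF assms(1) Idt_Hom[OF is_zero_object_Obj[OF assms(1)]] assms(2)]
    Comp_Idt_right[OF assms(2)] by simp

lemma zero_arrow_exists:
  assumes "is_zero_object C z" "x \<in> Obj C" "y \<in> Obj C"
  obtains f where "f \<in> Hom C x y" "is_zero_arrow C f"
proof -
  obtain h g where "h \<in> Hom C x z" "g \<in> Hom C z y"
    using zero_object_from_ex1[OF assms(1,3)] zero_object_to_ex1[OF assms(1,2)] by blast
  then show thesis
    using that zero_arrowI[OF assms(1)] Comp_Hom by blast
qed

text \<open>Composing with the identity shows that every arrow into or out of \<open>x\<close> is
  zero, and between two given objects there is exactly one zero arrow.\<close>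

lemma zero_objectI_Idt:
  assumes x: "x \<in> Obj C" and zero: "is_zero_arrow C (Idt C x)"
  shows "is_zero_object C x"
proof -
  obtain z a b where z: "is_zero_object C z" "b \<in> Hom C x z" "a \<in> Hom C z x" "Idt C x = a \<cdot> b"
    using zero Idt_Hom[OF x] by (rule zero_arrowE)
  have "is_zero_arrow C f" if "f \<in> Hom C x y" for f y
    using zero_arrow_comp_left[OF zero Idt_Hom[OF x] that] Comp_Idt_right[OF that] by simp
  moreover have "is_zero_arrow C f" if "f \<in> Hom C y x" for f y
    using zero_arrow_comp_right[OF zero Idt_Hom[OF x] that] Comp_Idt_left[OF that] by simp
  ultimately show ?thesis
    unfolding is_zero_object_def is_initial_def is_terminal_def
    using x zero_arrow_exists[OF z(1)] zero_arrow_unique by metis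
qed

section \<open>Cokernels: cancellation, detection of zero, uniqueness up to isomorphism\<close>

lemma cokernelD:
  assumes "is_cokernel C f q" "f \<in> Hom C x y"
  shows cokernel_Hom: "q \<in> Hom C y (Cod C q)"
    and cokernel_zero: "is_zero_arrow C (q \<cdot> f)"
    and cokernel_ex1: "\<And>t w. t \<in> Hom C y w \<Longrightarrow> is_zero_arrow C (t \<cdot> f) \<Longrightarrow>
      \<exists>!u. u \<in> Hom C (Cod C q) w \<and> u \<cdot> q = t"
  using assms unfolding is_cokernel_def Hom_def by auto

text \<open>Both \<open>u\<close> and \<open>v\<close> are factorizations of the single arrow
  \<open>v \<cdot> q\<close>, which kills \<open>f\<close>.\<close>

lemma cokernel_epi:
  assumes q: "is_cokernel C f q" and f: "f \<in> Hom C x y"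
    and u: "u \<in> Hom C (Cod C q) w" and v: "v \<in> Hom C (Cod C q) w" and eq: "u \<cdot> q = v \<cdot> q"
  shows "u = v"
proof -
  note Q = cokernelD[OF q f]
  have "is_zero_arrow C ((v \<cdot> q) \<cdot> f)"
    using zero_arrow_comp_left[OF Q(2) Comp_Hom[OF f Q(1)] v] Comp_assoc[OF f Q(1) v] by simp
  then show ?thesis
    using Q(3)[OF Comp_Hom[OF Q(1) v]] u v eq by metis
qed

text \<open>Cancellation of \<open>q\<close> against the zero arrow parallel to \<open>u\<close>.
  This is how a test on arrows out of a cokernel object is moved to arrows out of the object it is a
  quotient of.\<close>

lemma cokernel_reflects_zero:
  assumes q: "is_cokernel C f q" and f: "f \<in> Hom C x y"
    and u: "u \<in> Hom C (Cod C q) w" and zero: "is_zero_arrow C (u \<cdot> q)"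
  shows "is_zero_arrow C u"
proof -
  note Q = cokernelD[OF q f]
  obtain z where "is_zero_object C z"
    using zero by (auto simp: is_zero_arrow_def)
  then obtain v where v: "v \<in> Hom C (Cod C q) w" "is_zero_arrow C v"
    using zero_arrow_exists Hom_Obj[OF u] by metis
  have "v \<cdot> q = u \<cdot> q"
    using zero_arrow_unique[OF zero_arrow_comp_right[OF v(2,1) Q(1)] Comp_Hom[OF Q(1) v(1)] zero
        Comp_Hom[OF Q(1) u]] .
  then show ?thesis
    using cokernel_epi[OF q f v(1) u] v(2) by simp
qed

lemma cokernel_zero_object_iff:
  assumes q: "is_cokernel C f q" and f: "f \<in> Hom C x y"
  shows "is_zero_object C (Cod C q) \<longleftrightarrow>
    (\<forall>w. \<forall>t\<in>Hom C y w. is_zero_arrow C (t \<cdot> f) \<longrightarrow> is_zero_arrow C t)"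
proof (intro iffI allI ballI impI)
  fix w t
  assume "is_zero_object C (Cod C q)" "t \<in> Hom C y w" "is_zero_arrow C (t \<cdot> f)"
  then show "is_zero_arrow C t"
    using cokernelD[OF q f] zero_arrow_from_zero_object zero_arrow_comp_right by metis
next
  assume *: "\<forall>w. \<forall>t\<in>Hom C y w. is_zero_arrow C (t \<cdot> f) \<longrightarrow> is_zero_arrow C t"
  note Q = cokernelD[OF q f]
  \<comment> \<open>The test is applied to \<open>q\<close> itself: a zero projection forces the
    identity of its codomain to be zero.\<close>
  have "is_zero_arrow C (Idt C (Cod C q) \<cdot> q)"
    using * Q(1,2) Comp_Idt_left[OF Q(1)] by simp
  then show "is_zero_object C (Cod C q)"
    using cokernel_reflects_zero[OF q f] Idt_Hom Hom_Obj[OF Q(1)] zero_objectI_Idt by blast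
qed

text \<open>Serves to pass from the pointwise cokernel of a natural transformation to the one that
  \<open>coker\<close> happens to select.\<close>

lemma cokernel_comp_iso:
  assumes q: "is_cokernel C f q" and f: "f \<in> Hom C x y"
    and u: "u \<in> Hom C (Cod C q) w" and v: "v \<in> Hom C w (Cod C q)"
    and vu: "v \<cdot> u = Idt C (Cod C q)" and uv: "u \<cdot> v = Idt C w"
  shows "is_cokernel C f (u \<cdot> q)"
  unfolding is_cokernel_def
proof (intro conjI ballI impI)
  note Q = cokernelD[OF q f]
  have uq: "u \<cdot> q \<in> Hom C y w"
    using Comp_Hom[OF Q(1) u] .
  then show "u \<cdot> q \<in> Arr C" "Dom C (u \<cdot> q) = Cod C f" "f \<in> Arr C"
    using f by (auto simp: Hom_def)
  show "is_zero_arrow C ((u \<cdot> q) \<cdot> f)"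
    using zero_arrow_comp_left[OF Q(2) Comp_Hom[OF f Q(1)] u] Comp_assoc[OF f Q(1) u] by simp
  fix t assume "t \<in> Arr C" "Dom C t = Cod C f" and zero: "is_zero_arrow C (t \<cdot> f)"
  then have t: "t \<in> Hom C y (Cod C t)"
    using f by (auto simp: Hom_def)
  obtain r where r: "r \<in> Hom C (Cod C q) (Cod C t)" "r \<cdot> q = t"
    using Q(3)[OF t zero] by blast
  show "\<exists>!s. s \<in> Hom C (Cod C (u \<cdot> q)) (Cod C t) \<and> s \<cdot> (u \<cdot> q) = t"
    unfolding Hom_Cod[OF uq]
  proof (rule ex1I[of _ "r \<cdot> v"], intro conjI)
    show rv: "r \<cdot> v \<in> Hom C w (Cod C t)"
      using Comp_Hom[OF v r(1)] .
    have "(r \<cdot> v) \<cdot> u = r"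
      using Comp_assoc[OF u v r(1)] vu Comp_Idt_right[OF r(1)] by simp
    then show "(r \<cdot> v) \<cdot> (u \<cdot> q) = t"
      using Comp_assoc[OF Q(1) u rv] r(2) by simp
  next
    fix s assume "s \<in> Hom C w (Cod C t) \<and> s \<cdot> (u \<cdot> q) = t"
    then have s: "s \<in> Hom C w (Cod C t)" and "s \<cdot> (u \<cdot> q) = t"
      by auto
    then have "(s \<cdot> u) \<cdot> q = r \<cdot> q"
      using Comp_assoc[OF Q(1) u s] r(2) by simp
    then have "s \<cdot> u = r"
      by (rule cokernel_epi[OF q f Comp_Hom[OF u s] r(1)])
    then show "s = r \<cdot> v"
      using Comp_assoc[OF v u s] uv Comp_Idt_right[OF s] by simp
  qed
qed

lemma cokernels_isomorphic:
  assumes q: "is_cokernel C f q" and q': "is_cokernel C f q'" and f: "f \<in> Hom C x y"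
  obtains u v where "u \<in> Hom C (Cod C q) (Cod C q')" "v \<in> Hom C (Cod C q') (Cod C q)"
    "u \<cdot> q = q'" "v \<cdot> u = Idt C (Cod C q)" "u \<cdot> v = Idt C (Cod C q')"
proof -
  note Q = cokernelD[OF q f] and Q' = cokernelD[OF q' f]
  obtain u where u: "u \<in> Hom C (Cod C q) (Cod C q')" "u \<cdot> q = q'"
    using Q(3)[OF Q'(1,2)] by blast
  obtain v where v: "v \<in> Hom C (Cod C q') (Cod C q)" "v \<cdot> q' = q"
    using Q'(3)[OF Q(1,2)] by blast
  have "(v \<cdot> u) \<cdot> q = Idt C (Cod C q) \<cdot> q" "(u \<cdot> v) \<cdot> q' = Idt C (Cod C q') \<cdot> q'"
    using Comp_assoc[OF Q(1) u(1) v(1)] Comp_assoc[OF Q'(1) v(1) u(1)] u(2) v(2)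
      Comp_Idt_left[OF Q(1)] Comp_Idt_left[OF Q'(1)] by simp_all
  then have "v \<cdot> u = Idt C (Cod C q)" "u \<cdot> v = Idt C (Cod C q')"
    using cokernel_epi[OF q f Comp_Hom[OF u(1) v(1)] Idt_Hom]
      cokernel_epi[OF q' f Comp_Hom[OF v(1) u(1)] Idt_Hom] Hom_Obj u(1) by blast+
  then show thesis
    using that u v by blast
qed

end

section \<open>Finite coproducts\<close>

context abelian_category
begin

lemma zero_arrow_Hom_exists:
  assumes "x \<in> Obj C" "y \<in> Obj C"
  obtains f where "f \<in> Hom C x y" "is_zero_arrow C f"
  using zero_object_exists zero_arrow_exists assms by metis

lemma coker_is_cokernel: "f \<in> Hom C x y \<Longrightarrow> is_cokernel C f (coker C f)"
  unfolding coker_def by (rule someI_ex[OF cokernel_exists]) (rule Hom_Arr)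

text \<open>The axioms supply binary coproducts only. The \<open>n\<close>-fold one is obtained by
  adding one summand at a time; the coproduct of the empty family is an initial object. Without this
  existence the choice in \<open>cr_source\<close> would be meaningless.\<close>

lemma finite_coproduct_exists:
  "(\<And>i. i < n \<Longrightarrow> X i \<in> Obj C) \<Longrightarrow> \<exists>S s. is_coproduct C {..<n::nat} X S s"
proof (induction n)
  case 0
  obtain z where "is_zero_object C z"
    using zero_object_exists by blast
  then have "is_coproduct C {..<0} X z s" for s
    by (simp add: is_coproduct_def is_zero_object_def is_initial_def)
  then show ?case
    by blast
next
  case (Suc n)
  obtain S s where S: "is_coproduct C {..<n} X S s"
    using Suc by force
  then have SObj: "S \<in> Obj C" and s: "\<And>i. i < n \<Longrightarrow> s i \<in> Hom C (X i) S"
    by (auto simp: is_coproduct_def)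
  obtain T t where T: "is_coproduct C UNIV (\<lambda>b. if b then S else X n) T t"
    using binary_coproduct_exists SObj Suc.prems by blast
  then have TObj: "T \<in> Obj C" and t: "t True \<in> Hom C S T" "t False \<in> Hom C (X n) T"
    unfolding is_coproduct_def by (auto dest: spec[of _ True] spec[of _ False])
  define r where "r i = (if i < n then t True \<cdot> s i else t False)" for i
  have "is_coproduct C {..<Suc n} X T r"
    unfolding is_coproduct_def
  proof (intro conjI ballI allI impI TObj)
    show "r i \<in> Hom C (X i) T" if "i \<in> {..<Suc n}" for i
    proof (cases "i < n")
      case True
      then show ?thesis
        using Comp_Hom[OF s t(1)] by (simp add: r_def)
    next
      case False
      then have "i = n"
        using that by simp
      then show ?thesis
        using t(2) by (simp add: r_def)
    qed
    fix W g assume W: "W \<in> Obj C" and g: "\<forall>i\<in>{..<Suc n}. g i \<in> Hom C (X i) W"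
    obtain h where h: "h \<in> Hom C S W" "\<forall>i<n. h \<cdot> s i = g i"
      and h_unique: "\<And>h'. h' \<in> Hom C S W \<Longrightarrow> \<forall>i<n. h' \<cdot> s i = g i \<Longrightarrow> h' = h"
    proof -
      have "\<exists>!h. h \<in> Hom C S W \<and> (\<forall>i\<in>{..<n}. h \<cdot> s i = g i)"
        using S W g unfolding is_coproduct_def by simp
      then show thesis
        using that by (metis lessThan_iff)
    qed
    have "\<exists>!k. k \<in> Hom C T W \<and> (\<forall>b\<in>UNIV. k \<cdot> t b = (if b then h else g n))"
      using T W g h(1) unfolding is_coproduct_def by simp
    then have ex1: "\<exists>!k. k \<in> Hom C T W \<and> k \<cdot> t True = h \<and> k \<cdot> t False = g n"
      by (simp add: all_bool_eq conj_commute)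
    \<comment> \<open>The binary condition at \<open>True\<close> unfolds into one condition per old
      summand, since an arrow out of \<open>S\<close> is determined by its composites with the
      injections. The two conditions on \<open>k\<close> are thus equivalent, and unique existence
      transfers.\<close>
    have "(k \<cdot> t True = h \<and> k \<cdot> t False = g n) = (\<forall>i\<in>{..<Suc n}. k \<cdot> r i = g i)"
      if k: "k \<in> Hom C T W" for k
    proof -
      have "(k \<cdot> t True = h) = (\<forall>i<n. (k \<cdot> t True) \<cdot> s i = g i)"
        using h h_unique Comp_Hom[OF t(1) k] by blast
      moreover have "(k \<cdot> t True) \<cdot> s i = k \<cdot> r i" if "i < n" for i
        using Comp_assoc[OF s[OF that] t(1) k] that by (simp add: r_def)
      ultimately show ?thesis
        by (auto simp: r_def less_Suc_eq)
    qed
    then show "\<exists>!k. k \<in> Hom C T W \<and> (\<forall>i\<in>{..<Suc n}. k \<cdot> r i = g i)"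
      using ex1 by (simp cong: conj_cong)
  qed
  then show ?case
    by blast
qed

end

section \<open>Zero objects and cokernels of functor categories\<close>

lemma Fct_simps [simp]:
  "(F \<in> Obj (Fct C D)) = is_functor C D F"
  "(t \<in> Arr (Fct C D)) = is_ntrans C D t"
  "Dom (Fct C D) = nsrc"
  "Cod (Fct C D) = ntgt"
  "Idt (Fct C D) F = \<lparr>nsrc = F, ntgt = F, ncmp = (\<lambda>x\<in>Obj C. Idt D (fobj F x))\<rparr>"
  "Comp (Fct C D) t s = \<lparr>nsrc = nsrc s, ntgt = ntgt t, ncmp = (\<lambda>x\<in>Obj C. ncmp t x \<cdot>\<^bsub>D\<^esub> ncmp s x)\<rparr>"
  by (simp_all add: Fct_def)

lemma functorD:
  assumes "is_functor C D F"
  shows functor_Obj: "x \<in> Obj C \<Longrightarrow> fobj F x \<in> Obj D"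
    and functor_Hom: "f \<in> Hom C x y \<Longrightarrow> farr F f \<in> Hom D (fobj F x) (fobj F y)"
    and functor_Idt: "x \<in> Obj C \<Longrightarrow> farr F (Idt C x) = Idt D (fobj F x)"
    and functor_Comp: "f \<in> Hom C x y \<Longrightarrow> g \<in> Hom C y z \<Longrightarrow>
      farr F (g \<cdot>\<^bsub>C\<^esub> f) = farr F g \<cdot>\<^bsub>D\<^esub> farr F f"
  using assms by (auto simp: is_functor_def Hom_def)

lemma ntransD:
  assumes "is_ntrans C D t"
  shows ntrans_nsrc: "is_functor C D (nsrc t)" and ntrans_ntgt: "is_functor C D (ntgt t)"
    and ntrans_Hom: "x \<in> Obj C \<Longrightarrow> ncmp t x \<in> Hom D (fobj (nsrc t) x) (fobj (ntgt t) x)"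
    and ntrans_natural: "f \<in> Hom C x y \<Longrightarrow>
      ncmp t y \<cdot>\<^bsub>D\<^esub> farr (nsrc t) f = farr (ntgt t) f \<cdot>\<^bsub>D\<^esub> ncmp t x"
  using assms by (auto simp: is_ntrans_def Hom_def)

lemma ntrans_eqI:
  assumes "is_ntrans C D s" "is_ntrans C D t" "nsrc s = nsrc t" "ntgt s = ntgt t"
    and "\<And>x. x \<in> Obj C \<Longrightarrow> ncmp s x = ncmp t x"
  shows "s = t"
proof -
  have "ncmp s = ncmp t"
    using assms by (intro extensionalityI[of _ "Obj C"]) (auto simp: is_ntrans_def)
  then show ?thesis
    using assms by (cases s; cases t) simp
qed

text \<open>The source is kept arbitrary because two instances occur: \<open>M\<close>, for
  \<open>delta\<close>, and its powers, for \<open>crossed_effect\<close>.\<close>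

locale functors_to_abelian = S: category S + abelian_category A
  for S :: "('o, 'a, 'r) cat_scheme" and A :: "('p, 'b, 's) cat_scheme" (structure)
begin

lemma ntransI:
  assumes "is_functor S A F" "is_functor S A G"
    and Hom: "\<And>x. x \<in> Obj S \<Longrightarrow> c x \<in> Hom A (fobj F x) (fobj G x)"
    and nat: "\<And>f x y. f \<in> Hom S x y \<Longrightarrow> x \<in> Obj S \<Longrightarrow> y \<in> Obj S \<Longrightarrow>
      c y \<cdot> farr F f = farr G f \<cdot> c x"
  shows "\<lparr>nsrc = F, ntgt = G, ncmp = restrict c (Obj S)\<rparr> \<in> Hom (Fct S A) F G"
proof (intro HomI)
  show "\<lparr>nsrc = F, ntgt = G, ncmp = restrict c (Obj S)\<rparr> \<in> Arr (Fct S A)"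
    using assms S.Dom_Obj S.Cod_Obj unfolding is_ntrans_def Fct_simps
    by (simp add: HomI)
qed simp_all

lemma Fct_category: "category (Fct S A)"
proof
  fix f assume "f \<in> Arr (Fct S A)"
  then show "Dom (Fct S A) f \<in> Obj (Fct S A)" "Cod (Fct S A) f \<in> Obj (Fct S A)"
    by (auto simp: is_ntrans_def)
next
  fix F assume "F \<in> Obj (Fct S A)"
  then have F: "is_functor S A F" by simp
  show "Idt (Fct S A) F \<in> Hom (Fct S A) F F"
    unfolding Fct_simps
  proof (rule ntransI[OF F F])
    show "Idt A (fobj F x) \<in> Hom A (fobj F x) (fobj F x)" if "x \<in> Obj S" for x
      using Idt_Hom functor_Obj[OF F that] .
    show "Idt A (fobj F y) \<cdot> farr F f = farr F f \<cdot> Idt A (fobj F x)" if "f \<in> Hom S x y" for f x y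
      using Comp_Idt_left Comp_Idt_right functor_Hom[OF F that] by simp
  qed
next
  fix F G H t s assume "t \<in> Hom (Fct S A) F G" "s \<in> Hom (Fct S A) G H"
  then have t: "is_ntrans S A t" "nsrc t = F" "ntgt t = G"
    and s: "is_ntrans S A s" "nsrc s = G" "ntgt s = H"
    by (auto simp: Hom_def)
  note T = ntransD[OF t(1), unfolded t(2,3)] and U = ntransD[OF s(1), unfolded s(2,3)]
  show "s \<cdot>\<^bsub>Fct S A\<^esub> t \<in> Hom (Fct S A) F H"
    unfolding Fct_simps t(2) s(3)
  proof (rule ntransI[OF T(1) U(2)])
    show "ncmp s x \<cdot> ncmp t x \<in> Hom A (fobj F x) (fobj H x)" if "x \<in> Obj S" for x
      using Comp_Hom[OF T(3)[OF that] U(3)[OF that]] .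
    fix f x y assume f: "f \<in> Hom S x y" and x: "x \<in> Obj S" and y: "y \<in> Obj S"
    have "(ncmp s y \<cdot> ncmp t y) \<cdot> farr F f = ncmp s y \<cdot> (farr G f \<cdot> ncmp t x)"
      using Comp_assoc[OF functor_Hom[OF T(1) f] T(3)[OF y] U(3)[OF y]] T(4)[OF f] by simp
    also have "\<dots> = (farr H f \<cdot> ncmp s x) \<cdot> ncmp t x"
      using Comp_assoc[OF T(3)[OF x] functor_Hom[OF T(2) f] U(3)[OF y]] U(4)[OF f] by simp
    also have "\<dots> = farr H f \<cdot> (ncmp s x \<cdot> ncmp t x)"
      by (rule Comp_assoc[OF T(3)[OF x] U(3)[OF x] functor_Hom[OF U(2) f]])
    finally show "(ncmp s y \<cdot> ncmp t y) \<cdot> farr F f = farr H f \<cdot> (ncmp s x \<cdot> ncmp t x)" .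
  qed
  {
    fix K r assume "r \<in> Hom (Fct S A) H K"
    then have r: "is_ntrans S A r" "nsrc r = H" "ntgt r = K"
      by (auto simp: Hom_def)
    note V = ntransD[OF r(1), unfolded r(2,3)]
    show "(r \<cdot>\<^bsub>Fct S A\<^esub> s) \<cdot>\<^bsub>Fct S A\<^esub> t = r \<cdot>\<^bsub>Fct S A\<^esub> (s \<cdot>\<^bsub>Fct S A\<^esub> t)"
    proof -
      have "(ncmp r x \<cdot> ncmp s x) \<cdot> ncmp t x = ncmp r x \<cdot> (ncmp s x \<cdot> ncmp t x)" if "x \<in> Obj S" for x
        using Comp_assoc[OF T(3)[OF that] U(3)[OF that] V(3)[OF that]] .
      then show ?thesis
        by (simp cong: restrict_cong)
    qed
  }
next
  fix F G t assume "t \<in> Hom (Fct S A) F G"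
  then have t: "is_ntrans S A t" "nsrc t = F" "ntgt t = G"
    by (auto simp: Hom_def)
  note T = ntransD[OF t(1), unfolded t(2,3)]
  have [simp]: "ncmp t x = undefined" if "x \<notin> Obj S" for x
    using t(1) that by (auto simp: is_ntrans_def extensional_def)
  have "(\<lambda>x\<in>Obj S. Idt A (fobj G x) \<cdot> ncmp t x) = ncmp t"
    "(\<lambda>x\<in>Obj S. ncmp t x \<cdot> Idt A (fobj F x)) = ncmp t"
    using Comp_Idt_left[OF T(3)] Comp_Idt_right[OF T(3)] by (auto simp: restrict_def fun_eq_iff)
  then show "Idt (Fct S A) G \<cdot>\<^bsub>Fct S A\<^esub> t = t" "t \<cdot>\<^bsub>Fct S A\<^esub> Idt (Fct S A) F = t"
    using t(2,3) by (simp_all cong: restrict_cong)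
qed

text \<open>Any choice of zero components is natural: both sides of a naturality square are zero
  arrows with the same ends.\<close>

lemma pointwise_zero_arrow_ntrans:
  assumes F: "is_functor S A F" and G: "is_functor S A G"
  obtains t where "t \<in> Hom (Fct S A) F G" "\<And>x. x \<in> Obj S \<Longrightarrow> is_zero_arrow A (ncmp t x)"
proof -
  have "\<exists>f. f \<in> Hom A (fobj F x) (fobj G x) \<and> is_zero_arrow A f" if "x \<in> Obj S" for x
    using zero_arrow_Hom_exists functor_Obj[OF F that] functor_Obj[OF G that] by metis
  then obtain c where c: "c x \<in> Hom A (fobj F x) (fobj G x)" "is_zero_arrow A (c x)"
    if "x \<in> Obj S" for x
    by metis
  have "\<lparr>nsrc = F, ntgt = G, ncmp = restrict c (Obj S)\<rparr> \<in> Hom (Fct S A) F G"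
  proof (rule ntransI[OF F G c(1)])
    fix f x y assume f: "f \<in> Hom S x y" and x: "x \<in> Obj S" and y: "y \<in> Obj S"
    show "c y \<cdot> farr F f = farr G f \<cdot> c x"
      using zero_arrow_comp_right[OF c(2,1)[OF y] functor_Hom[OF F f]]
        zero_arrow_comp_left[OF c(2,1)[OF x] functor_Hom[OF G f]]
        Comp_Hom[OF functor_Hom[OF F f] c(1)[OF y]] Comp_Hom[OF c(1)[OF x] functor_Hom[OF G f]]
      by (intro zero_arrow_unique)
  qed
  then show thesis
    using that c(2) by fastforce
qed

text \<open>On a zero functor \<open>G\<close> the transformation with zero components has to be the
  identity, so the identity of each value is zero. Conversely, transformations to and from a
  pointwise zero functor exist with zero components and are unique at each object.\<close>

lemma Fct_zero_object_iff:
  "is_zero_object (Fct S A) G \<longleftrightarrow>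
    is_functor S A G \<and> (\<forall>x\<in>Obj S. is_zero_object A (fobj G x))"
proof (intro iffI conjI ballI)
  assume zero: "is_zero_object (Fct S A) G"
  show G: "is_functor S A G"
    using is_zero_object_Obj[OF zero] by simp
  fix x assume x: "x \<in> Obj S"
  obtain t where t: "t \<in> Hom (Fct S A) G G" "\<And>x. x \<in> Obj S \<Longrightarrow> is_zero_arrow A (ncmp t x)"
    using pointwise_zero_arrow_ntrans[OF G G] by blast
  have "t = Idt (Fct S A) G"
    using zero_object_from_ex1[OF zero is_zero_object_Obj[OF zero]] t(1)
      category.Idt_Hom[OF Fct_category is_zero_object_Obj[OF zero]] by blast
  then have "is_zero_arrow A (Idt A (fobj G x))"
    using t(2)[OF x] x by simp
  then show "is_zero_object A (fobj G x)"
    using zero_objectI_Idt functor_Obj[OF G x] by blast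
next
  assume "is_functor S A G \<and> (\<forall>x\<in>Obj S. is_zero_object A (fobj G x))"
  then have G: "is_functor S A G" and zero: "\<And>x. x \<in> Obj S \<Longrightarrow> is_zero_object A (fobj G x)"
    by auto
  have "s = t" if "s \<in> Hom (Fct S A) G H" "t \<in> Hom (Fct S A) G H" for s t H
  proof (rule ntrans_eqI)
    show "ncmp s x = ncmp t x" if x: "x \<in> Obj S" for x
      using zero_object_from_ex1[OF zero[OF x]] x that(1) \<open>s \<in> _\<close> \<open>t \<in> _\<close> ntrans_Hom[of S A _ x]
      by (metis Fct_simps(2-4) Hom_Arr Hom_Cod Hom_Dom Hom_Obj(2))
  qed (use that in \<open>auto simp: Hom_def\<close>)
  moreover have "s = t" if "s \<in> Hom (Fct S A) H G" "t \<in> Hom (Fct S A) H G" for s t H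
  proof (rule ntrans_eqI)
    show "ncmp s x = ncmp t x" if x: "x \<in> Obj S" for x
      using zero_object_to_ex1[OF zero[OF x]] x that(1) \<open>s \<in> _\<close> \<open>t \<in> _\<close> ntrans_Hom[of S A _ x]
      by (metis Fct_simps(2-4) Hom_Arr Hom_Cod Hom_Dom Hom_Obj(1))
  qed (use that in \<open>auto simp: Hom_def\<close>)
  moreover have "\<exists>t. t \<in> Hom (Fct S A) G H" if "is_functor S A H" for H
    by (rule pointwise_zero_arrow_ntrans[OF G that]) (rule exI)
  moreover have "\<exists>t. t \<in> Hom (Fct S A) H G" if "is_functor S A H" for H
    by (rule pointwise_zero_arrow_ntrans[OF that G]) (rule exI)
  ultimately have "\<exists>!t. t \<in> Hom (Fct S A) G H" "\<exists>!t. t \<in> Hom (Fct S A) H G"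
    if "is_functor S A H" for H
    using that by blast+
  then show "is_zero_object (Fct S A) G"
    using G by (simp add: is_zero_object_def is_initial_def is_terminal_def)
qed

lemma Fct_zero_object_exists: "\<exists>Z. is_zero_object (Fct S A) Z"
proof -
  obtain z where z: "is_zero_object A z"
    using zero_object_exists by blast
  note Z = Idt_Hom[OF is_zero_object_Obj[OF z]]
  have "is_functor S A \<lparr>fobj = (\<lambda>x\<in>Obj S. z), farr = (\<lambda>f\<in>Arr S. Idt A z)\<rparr>"
    using is_zero_object_Obj[OF z] Z Comp_Idt_left[OF Z] S.Dom_Obj S.Cod_Obj S.Idt_Hom S.Comp_Hom
    by (auto simp: is_functor_def Hom_def)
  then show ?thesis
    using z by (intro exI) (auto simp: Fct_zero_object_iff)
qed

text \<open>A zero arrow of the functor category must factor through one zero functor, which zero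
  components do not provide directly. Hence \<open>t\<close> is compared with a transformation
  \<open>s\<close> that has such a factorization: their components are parallel zero arrows.\<close>

lemma Fct_zero_arrow_iff:
  assumes "t \<in> Hom (Fct S A) F G"
  shows "is_zero_arrow (Fct S A) t \<longleftrightarrow> (\<forall>x\<in>Obj S. is_zero_arrow A (ncmp t x))"
proof
  assume "is_zero_arrow (Fct S A) t"
  then obtain Z g h where Z: "is_zero_object (Fct S A) Z" "h \<in> Hom (Fct S A) F Z"
    "g \<in> Hom (Fct S A) Z G" "t = g \<cdot>\<^bsub>Fct S A\<^esub> h"
    using category.zero_arrowE[OF Fct_category _ assms] by blast
  show "\<forall>x\<in>Obj S. is_zero_arrow A (ncmp t x)"
  proof
    fix x assume x: "x \<in> Obj S"
    have "ncmp h x \<in> Hom A (fobj F x) (fobj Z x)" "ncmp g x \<in> Hom A (fobj Z x) (fobj G x)"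
      using Z(2,3) ntrans_Hom[OF _ x] by (fastforce simp: Hom_def)+
    moreover have "is_zero_object A (fobj Z x)"
      using Z(1) x by (simp add: Fct_zero_object_iff)
    ultimately show "is_zero_arrow A (ncmp t x)"
      using Z(4) x zero_arrowI by simp
  qed
next
  assume zero: "\<forall>x\<in>Obj S. is_zero_arrow A (ncmp t x)"
  interpret FC: category "Fct S A" by (rule Fct_category)
  obtain Z where "is_zero_object (Fct S A) Z"
    using Fct_zero_object_exists by blast
  then obtain s where s: "s \<in> Hom (Fct S A) F G" "is_zero_arrow (Fct S A) s"
    using FC.zero_arrow_exists FC.Hom_Obj[OF assms] by metis
  then obtain Z g h where Z: "is_zero_object (Fct S A) Z" "h \<in> Hom (Fct S A) F Z"
    "g \<in> Hom (Fct S A) Z G" "s = g \<cdot>\<^bsub>Fct S A\<^esub> h"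
    using FC.zero_arrowE by blast
  have "s = t"
  proof (rule ntrans_eqI)
    fix x assume x: "x \<in> Obj S"
    have "ncmp h x \<in> Hom A (fobj F x) (fobj Z x)" "ncmp g x \<in> Hom A (fobj Z x) (fobj G x)"
      using Z(2,3) ntrans_Hom[OF _ x] by (fastforce simp: Hom_def)+
    moreover have "is_zero_object A (fobj Z x)"
      using Z(1) x by (simp add: Fct_zero_object_iff)
    ultimately have "is_zero_arrow A (ncmp s x)"
      using Z(4) x zero_arrowI by simp
    moreover have "ncmp s x \<in> Hom A (fobj F x) (fobj G x)" "ncmp t x \<in> Hom A (fobj F x) (fobj G x)"
      using s(1) assms ntrans_Hom[OF _ x] by (fastforce simp: Hom_def)+
    ultimately show "ncmp s x = ncmp t x"
      using zero x zero_arrow_unique by blast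
  qed (use s(1) assms in \<open>auto simp: Hom_def\<close>)
  then show "is_zero_arrow (Fct S A) t"
    using s(2) by simp
qed

section \<open>Cokernels of natural transformations are computed pointwise\<close>

lemma pointwise_cokernel:
  assumes t: "t \<in> Hom (Fct S A) F G"
  obtains q where "is_cokernel (Fct S A) t q" "\<And>x. x \<in> Obj S \<Longrightarrow> is_cokernel A (ncmp t x) (ncmp q x)"
proof -
  interpret FC: category "Fct S A" by (rule Fct_category)
  have t': "is_ntrans S A t" "nsrc t = F" "ntgt t = G"
    using t by (auto simp: Hom_def)
  note T = ntransD[OF t'(1), unfolded t'(2,3)]
  define c where "c x = coker A (ncmp t x)" for x
  have c: "is_cokernel A (ncmp t x) (c x)" if "x \<in> Obj S" for x
    unfolding c_def using coker_is_cokernel[OF T(3)[OF that]] .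
  have cHom: "c x \<in> Hom A (fobj G x) (Cod A (c x))" if "x \<in> Obj S" for x
    using cokernel_Hom[OF c T(3)] that by blast
  \<comment> \<open>Naturality of \<open>t\<close> rewrites
    \<open>c y \<cdot> farr G f \<cdot> ncmp t x\<close> as
    \<open>c y \<cdot> ncmp t y \<cdot> farr F f\<close>, which is zero. This defines the quotient
    functor \<open>Q\<close> on arrows; its functor laws follow by cancelling
    \<open>c x\<close>.\<close>
  have ex1: "\<exists>!u. u \<in> Hom A (Cod A (c x)) (Cod A (c y)) \<and> u \<cdot> c x = c y \<cdot> farr G f"
    if f: "f \<in> Hom S x y" for f x y
  proof -
    note xy = S.Hom_Obj[OF f]
    note tx = T(3)[OF xy(1)] and ty = T(3)[OF xy(2)] and Gf = functor_Hom[OF T(2) f]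
      and Ff = functor_Hom[OF T(1) f] and cy = cHom[OF xy(2)]
    have "(c y \<cdot> farr G f) \<cdot> ncmp t x = (c y \<cdot> ncmp t y) \<cdot> farr F f"
      using Comp_assoc[OF tx Gf cy] Comp_assoc[OF Ff ty cy] T(4)[OF f] by simp
    moreover have "is_zero_arrow A ((c y \<cdot> ncmp t y) \<cdot> farr F f)"
      using zero_arrow_comp_right[OF cokernel_zero[OF c ty] Comp_Hom[OF ty cy] Ff] xy(2) by blast
    ultimately show ?thesis
      using cokernel_ex1[OF c tx Comp_Hom[OF Gf cy]] xy(1) by simp
  qed
  define Q where "Q = \<lparr>fobj = (\<lambda>x\<in>Obj S. Cod A (c x)),
    farr = (\<lambda>f\<in>Arr S. THE u. u \<in> Hom A (Cod A (c (Dom S f))) (Cod A (c (Cod S f))) \<and>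
      u \<cdot> c (Dom S f) = c (Cod S f) \<cdot> farr G f)\<rparr>"
  have Qobj: "fobj Q x = Cod A (c x)" if "x \<in> Obj S" for x
    using that by (simp add: Q_def)
  have Qarr: "farr Q f \<in> Hom A (Cod A (c x)) (Cod A (c y)) \<and> farr Q f \<cdot> c x = c y \<cdot> farr G f"
    if f: "f \<in> Hom S x y" for f x y
    using theI'[OF ex1[OF f]] f by (auto simp: Q_def Hom_def)
  have Qfun: "is_functor S A Q"
    unfolding is_functor_def
  proof (intro conjI ballI impI)
    show "fobj Q \<in> extensional (Obj S)" "farr Q \<in> extensional (Arr S)"
      by (auto simp: Q_def)
    show "fobj Q x \<in> Obj A" if "x \<in> Obj S" for x
      using Hom_Obj(2)[OF cHom[OF that]] that by (simp add: Qobj)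
    show "farr Q f \<in> Hom A (fobj Q (Dom S f)) (fobj Q (Cod S f))" if "f \<in> Arr S" for f
      using Qarr[of f] that S.Dom_Obj S.Cod_Obj by (simp add: Qobj Hom_def)
    show "farr Q (Idt S x) = Idt A (fobj Q x)" if x: "x \<in> Obj S" for x
    proof -
      have "farr Q (Idt S x) \<cdot> c x = Idt A (Cod A (c x)) \<cdot> c x"
        using Qarr[OF S.Idt_Hom[OF x]] functor_Idt[OF T(2) x] Comp_Idt_left[OF cHom[OF x]]
          Comp_Idt_right[OF cHom[OF x]] by simp
      then show ?thesis
        using cokernel_epi[OF c[OF x] T(3)[OF x]] Qarr[OF S.Idt_Hom[OF x]] Qobj[OF x]
          Idt_Hom[OF Hom_Obj(2)[OF cHom[OF x]]] by metis
    qed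
    fix f g assume "f \<in> Arr S" "g \<in> Arr S" "Cod S f = Dom S g"
    then obtain x y z where f: "f \<in> Hom S x y" and g: "g \<in> Hom S y z"
      by (auto simp: Hom_def)
    note x = S.Hom_Obj(1)[OF f] and y = S.Hom_Obj(2)[OF f] and z = S.Hom_Obj(2)[OF g]
    note gf = S.Comp_Hom[OF f g] and Gf = functor_Hom[OF T(2) f] and Gg = functor_Hom[OF T(2) g]
    note Qf = Qarr[OF f, THEN conjunct1] and Qg = Qarr[OF g, THEN conjunct1]
    have "(farr Q g \<cdot> farr Q f) \<cdot> c x = farr Q g \<cdot> (c y \<cdot> farr G f)"
      using Comp_assoc[OF cHom[OF x] Qf Qg] Qarr[OF f] by simp
    also have "\<dots> = (c z \<cdot> farr G g) \<cdot> farr G f"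
      using Comp_assoc[OF Gf cHom[OF y] Qg] Qarr[OF g] by simp
    also have "\<dots> = c z \<cdot> farr G (g \<cdot>\<^bsub>S\<^esub> f)"
      using Comp_assoc[OF Gf Gg cHom[OF z]] functor_Comp[OF T(2) f g] by simp
    also have "\<dots> = farr Q (g \<cdot>\<^bsub>S\<^esub> f) \<cdot> c x"
      using Qarr[OF gf] by simp
    finally show "farr Q (g \<cdot>\<^bsub>S\<^esub> f) = farr Q g \<cdot> farr Q f"
      using cokernel_epi[OF c[OF x] T(3)[OF x] _ Comp_Hom[OF Qf Qg]] Qarr[OF gf] by metis
  qed
  define q where "q = \<lparr>nsrc = G, ntgt = Q, ncmp = restrict c (Obj S)\<rparr>"
  have q: "q \<in> Hom (Fct S A) G Q"
    unfolding q_def using cHom Qarr by (intro ntransI[OF T(2) Qfun]) (simp_all add: Qobj)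
  have qx: "ncmp q x = c x" if "x \<in> Obj S" for x
    using that by (simp add: q_def)
  have "is_cokernel (Fct S A) t q"
    unfolding is_cokernel_def
  proof (intro conjI ballI impI)
    show "t \<in> Arr (Fct S A)" "q \<in> Arr (Fct S A)" "Dom (Fct S A) q = Cod (Fct S A) t"
      using t q by (auto simp: Hom_def)
    show "is_zero_arrow (Fct S A) (q \<cdot>\<^bsub>Fct S A\<^esub> t)"
      unfolding Fct_zero_arrow_iff[OF FC.Comp_Hom[OF t q]]
      using cokernel_zero[OF c T(3)] by (simp add: qx)
    fix s assume s: "s \<in> Arr (Fct S A)" and dom: "Dom (Fct S A) s = Cod (Fct S A) t"
      and zero: "is_zero_arrow (Fct S A) (s \<cdot>\<^bsub>Fct S A\<^esub> t)"
    define H where "H = ntgt s"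
    have s': "is_ntrans S A s" "nsrc s = G" "ntgt s = H" and sH: "s \<in> Hom (Fct S A) G H"
      using s dom t by (auto simp: H_def Hom_def)
    note U = ntransD[OF s'(1), unfolded s'(2,3)]
    have "is_zero_arrow A (ncmp s x \<cdot> ncmp t x)" if "x \<in> Obj S" for x
      using zero that unfolding Fct_zero_arrow_iff[OF FC.Comp_Hom[OF t sH]] by simp
    then have "\<exists>!u. u \<in> Hom A (Cod A (c x)) (fobj H x) \<and> u \<cdot> c x = ncmp s x" if "x \<in> Obj S" for x
      using cokernel_ex1[OF c T(3) U(3)] that by blast
    then obtain u where u: "u x \<in> Hom A (Cod A (c x)) (fobj H x)" "u x \<cdot> c x = ncmp s x"
      if "x \<in> Obj S" for x
      by metis
    define w where "w = \<lparr>nsrc = Q, ntgt = H, ncmp = restrict u (Obj S)\<rparr>"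
    \<comment> \<open>The factorizations \<open>u x\<close> are found object by object; they are
      natural because the squares agree after composition with \<open>c x\<close>.\<close>
    have w: "w \<in> Hom (Fct S A) Q H"
      unfolding w_def
    proof (rule ntransI[OF Qfun U(2)])
      show "u x \<in> Hom A (fobj Q x) (fobj H x)" if "x \<in> Obj S" for x
        using u that by (simp add: Qobj)
      fix f x y assume f: "f \<in> Hom S x y" and x: "x \<in> Obj S" and y: "y \<in> Obj S"
      note Qf = Qarr[OF f, THEN conjunct1] and Hf = functor_Hom[OF U(2) f]
        and Gf = functor_Hom[OF T(2) f]
      have "(u y \<cdot> farr Q f) \<cdot> c x = (u y \<cdot> c y) \<cdot> farr G f"
        using Comp_assoc[OF cHom[OF x] Qf u(1)[OF y]] Comp_assoc[OF Gf cHom[OF y] u(1)[OF y]]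
          Qarr[OF f] by simp
      also have "\<dots> = (farr H f \<cdot> u x) \<cdot> c x"
        using Comp_assoc[OF cHom[OF x] u(1)[OF x] Hf] U(4)[OF f] u(2) x y by simp
      finally show "u y \<cdot> farr Q f = farr H f \<cdot> u x"
        by (rule cokernel_epi[OF c[OF x] T(3)[OF x] Comp_Hom[OF Qf u(1)[OF y]]
              Comp_Hom[OF u(1)[OF x] Hf]])
    qed
    have cods: "Cod (Fct S A) q = Q" "Cod (Fct S A) s = H"
      using q s' by (auto simp: Hom_def)
    show "\<exists>!v. v \<in> Hom (Fct S A) (Cod (Fct S A) q) (Cod (Fct S A) s) \<and> v \<cdot>\<^bsub>Fct S A\<^esub> q = s"
      unfolding cods
    proof (rule ex1I[of _ w], intro conjI w)
      show "w \<cdot>\<^bsub>Fct S A\<^esub> q = s"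
        by (rule ntrans_eqI[of S A])
          (use FC.Comp_Hom[OF q w] s' u(2) in \<open>auto simp: Hom_def w_def q_def\<close>)
      fix v assume v: "v \<in> Hom (Fct S A) Q H \<and> v \<cdot>\<^bsub>Fct S A\<^esub> q = s"
      then have v': "is_ntrans S A v" "nsrc v = Q" "ntgt v = H"
        by (auto simp: Hom_def)
      show "v = w"
      proof (rule ntrans_eqI[of S A])
        fix x assume x: "x \<in> Obj S"
        have "ncmp (v \<cdot>\<^bsub>Fct S A\<^esub> q) x = ncmp s x"
          using v by simp
        then have "ncmp v x \<cdot> c x = u x \<cdot> c x"
          using x u(2)[OF x] by (simp add: qx)
        then show "ncmp v x = ncmp w x"
          using cokernel_epi[OF c[OF x] T(3)[OF x] _ u(1)[OF x]] ntrans_Hom[OF v'(1) x] v' x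
          by (simp add: Qobj w_def)
      qed (use w v' in \<open>auto simp: Hom_def\<close>)
    qed
  qed
  then show thesis
    using that c by (simp add: qx)
qed

text \<open>The pointwise construction gives \<open>coker\<close> something to choose from. The
  chosen cokernel is isomorphic to the pointwise one, and the components of this isomorphism are
  isomorphisms in \<open>A\<close>, so it is pointwise as well.\<close>

lemma Fct_coker:
  assumes t: "t \<in> Hom (Fct S A) F G"
  shows "is_cokernel (Fct S A) t (coker (Fct S A) t)"
    and "x \<in> Obj S \<Longrightarrow> is_cokernel A (ncmp t x) (ncmp (coker (Fct S A) t) x)"
proof -
  interpret FC: category "Fct S A" by (rule Fct_category)
  obtain q where q: "is_cokernel (Fct S A) t q"
    "\<And>x. x \<in> Obj S \<Longrightarrow> is_cokernel A (ncmp t x) (ncmp q x)"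
    using pointwise_cokernel[OF t] by blast
  then show coker: "is_cokernel (Fct S A) t (coker (Fct S A) t)"
    unfolding coker_def by (metis someI_ex)
  assume x: "x \<in> Obj S"
  define q' where "q' = coker (Fct S A) t"
  obtain u v where u: "u \<in> Hom (Fct S A) (ntgt q) (ntgt q')"
    and v: "v \<in> Hom (Fct S A) (ntgt q') (ntgt q)" and uq: "u \<cdot>\<^bsub>Fct S A\<^esub> q = q'"
    and vu: "v \<cdot>\<^bsub>Fct S A\<^esub> u = Idt (Fct S A) (ntgt q)"
    and uv: "u \<cdot>\<^bsub>Fct S A\<^esub> v = Idt (Fct S A) (ntgt q')"
    using FC.cokernels_isomorphic[OF q(1) coker t] unfolding q'_def Fct_simps(4) by blast
  have qq: "q \<in> Hom (Fct S A) G (ntgt q)"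
    using FC.cokernel_Hom[OF q(1) t] by simp
  have tx: "ncmp t x \<in> Hom A (fobj F x) (fobj G x)"
    and qx: "ncmp q x \<in> Hom A (fobj G x) (fobj (ntgt q) x)"
    and ux: "ncmp u x \<in> Hom A (fobj (ntgt q) x) (fobj (ntgt q') x)"
    and vx: "ncmp v x \<in> Hom A (fobj (ntgt q') x) (fobj (ntgt q) x)"
    using t qq u v ntrans_Hom[OF _ x] by (fastforce simp: Hom_def)+
  have "ncmp u x \<cdot> ncmp q x = ncmp q' x" "ncmp v x \<cdot> ncmp u x = Idt A (fobj (ntgt q) x)"
    "ncmp u x \<cdot> ncmp v x = Idt A (fobj (ntgt q') x)"
    using arg_cong[OF uq, of "\<lambda>s. ncmp s x"] arg_cong[OF uv, of "\<lambda>s. ncmp s x"]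
      arg_cong[OF vu, of "\<lambda>s. ncmp s x"] x by simp_all
  then show "is_cokernel A (ncmp t x) (ncmp (coker (Fct S A) t) x)"
    using cokernel_comp_iso[OF q(2)[OF x] tx, of "ncmp u x" "fobj (ntgt q') x" "ncmp v x"]
      ux vx Hom_Cod[OF qx] unfolding q'_def by simp
qed

end

section \<open>Powers of a category and canonical arrows\<close>

lemma cat_power_simps [simp]:
  "as \<in> Obj (cat_power C m) \<longleftrightarrow> length as = m \<and> set as \<subseteq> Obj C"
  "fs \<in> Arr (cat_power C m) \<longleftrightarrow> length fs = m \<and> set fs \<subseteq> Arr C"
  "Dom (cat_power C m) = map (Dom C)"
  "Cod (cat_power C m) = map (Cod C)"
  "Idt (cat_power C m) = map (Idt C)"
  "Comp (cat_power C m) = map2 (Comp C)"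
  by (simp_all add: cat_power_def)

lemma Hom_cat_power_iff:
  "fs \<in> Hom (cat_power C m) xs ys \<longleftrightarrow>
    length fs = m \<and> length xs = m \<and> length ys = m \<and> (\<forall>i<m. fs ! i \<in> Hom C (xs ! i) (ys ! i))"
  by (auto simp: Hom_def list_eq_iff_nth_eq subset_iff in_set_conv_nth)

context category
begin

lemma category_cat_power: "category (cat_power C m)"
proof
  fix fs assume "fs \<in> Arr (cat_power C m)"
  then show "Dom (cat_power C m) fs \<in> Obj (cat_power C m)"
    "Cod (cat_power C m) fs \<in> Obj (cat_power C m)"
    using Dom_Obj Cod_Obj by auto
next
  fix as assume "as \<in> Obj (cat_power C m)"
  then show "Idt (cat_power C m) as \<in> Hom (cat_power C m) as as"
    using Idt_Hom nth_mem by (fastforce simp: Hom_cat_power_iff)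
next
  fix fs gs xs ys zs
  assume "fs \<in> Hom (cat_power C m) xs ys" "gs \<in> Hom (cat_power C m) ys zs"
  then show "gs \<cdot>\<^bsub>cat_power C m\<^esub> fs \<in> Hom (cat_power C m) xs zs"
    by (auto simp: Hom_cat_power_iff intro: Comp_Hom)
next
  fix fs xs ys assume "fs \<in> Hom (cat_power C m) xs ys"
  then show "Idt (cat_power C m) ys \<cdot>\<^bsub>cat_power C m\<^esub> fs = fs"
    "fs \<cdot>\<^bsub>cat_power C m\<^esub> Idt (cat_power C m) xs = fs"
    by (auto simp: Hom_cat_power_iff list_eq_iff_nth_eq intro: Comp_Idt_left Comp_Idt_right)
next
  fix fs gs hs ws xs ys zs
  assume "fs \<in> Hom (cat_power C m) ws xs" "gs \<in> Hom (cat_power C m) xs ys"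
    "hs \<in> Hom (cat_power C m) ys zs"
  then show "(hs \<cdot>\<^bsub>cat_power C m\<^esub> gs) \<cdot>\<^bsub>cat_power C m\<^esub> fs =
      hs \<cdot>\<^bsub>cat_power C m\<^esub> (gs \<cdot>\<^bsub>cat_power C m\<^esub> fs)"
    by (auto simp: Hom_cat_power_iff list_eq_iff_nth_eq intro: Comp_assoc)
qed

end

lemma omit_Cons [simp]: "omit 0 (x # as) = as" "omit (Suc i) (x # as) = x # omit i as"
  by (simp_all add: omit_def)

lemma set_omit_subset: "set (omit i as) \<subseteq> set as"
  by (auto simp: omit_def dest: in_set_takeD in_set_dropD)

section \<open>Sums of lists and the canonical arrows between them\<close>

context mon_ini
begin

lemma init_arr_Hom: "x \<in> Obj M \<Longrightarrow> init_arr M x \<in> Hom M \<zero> x"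
  unfolding init_arr_def by (rule theI') (use Unit_initial in \<open>simp add: is_initial_def\<close>)

lemma from_Unit_unique: "f \<in> Hom M \<zero> x \<Longrightarrow> g \<in> Hom M \<zero> x \<Longrightarrow> f = g"
  using Unit_initial Hom_Obj(2) by (metis is_initial_def)

lemma osum_list_Nil [simp]: "osum_list M [] = \<zero>"
  and osum_list_Cons [simp]: "osum_list M (x # as) = x \<oplus> osum_list M as"
  by (simp_all add: osum_list_def)

lemma asum_list_Cons: "asum_list M (f # fs) = f \<boxplus> asum_list M fs"
  by (simp add: asum_list_def)

lemma osum_list_Obj: "set as \<subseteq> Obj M \<Longrightarrow> osum_list M as \<in> Obj M"
  by (induction as) (auto simp: Unit_Obj OSum_Obj)

lemma asum_list_Idt: "set as \<subseteq> Obj M \<Longrightarrow> asum_list M (map (Idt M) as) = Idt M (osum_list M as)"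
  by (induction as) (auto simp: asum_list_def ASum_Idt osum_list_Obj)

lemma omit_arr_Cons_0:
  "set as \<subseteq> Obj M \<Longrightarrow> omit_arr M 0 (x # as) = init_arr M x \<boxplus> Idt M (osum_list M as)"
  by (simp add: omit_arr_def asum_list_Cons asum_list_Idt)

lemma omit_arr_Cons_Suc: "omit_arr M (Suc i) (x # as) = Idt M x \<boxplus> omit_arr M i as"
  by (simp add: omit_arr_def asum_list_Cons)

lemma unit_into_sum_Hom:
  assumes "x \<in> Obj M" "y \<in> Obj M"
  shows "init_arr M x \<boxplus> Idt M y \<in> Hom M y (x \<oplus> y)"
  using ASum_Hom[OF init_arr_Hom[OF assms(1)] Idt_Hom[OF assms(2)]] OSum_Unit_left[OF assms(2)]
  by simp

lemma omit_arr_Hom: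
  "set as \<subseteq> Obj M \<Longrightarrow> i < length as \<Longrightarrow>
    omit_arr M i as \<in> Hom M (osum_list M (omit i as)) (osum_list M as)"
proof (induction as arbitrary: i)
  case (Cons x as)
  then show ?case
    by (cases i)
      (auto simp: omit_arr_Cons_0 omit_arr_Cons_Suc osum_list_Obj
        intro!: unit_into_sum_Hom ASum_Hom Idt_Hom)
qed simp

lemma asum_list_Hom:
  "set fs \<subseteq> Arr M \<Longrightarrow>
    asum_list M fs \<in> Hom M (osum_list M (map (Dom M) fs)) (osum_list M (map (Cod M) fs))"
  by (induction fs) (auto simp: asum_list_def Idt_Hom Unit_Obj intro!: ASum_Hom HomI)

text \<open>Two arrows out of the initial object \<open>\<zero>\<close> with the same target
  coincide.\<close>

lemma init_arr_OSum:
  assumes "x \<in> Obj M" "y \<in> Obj M"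
  shows "init_arr M (x \<oplus> y) = (init_arr M x \<boxplus> Idt M y) \<cdot> init_arr M y"
  using Comp_Hom[OF init_arr_Hom[OF assms(2)] unit_into_sum_Hom[OF assms]]
    init_arr_Hom[OF OSum_Obj[OF assms]] from_Unit_unique by blast

text \<open>By the interchange law both sides equal \<open>init_arr M x \<boxplus> f\<close>; on the
  left, \<open>f\<close> is first read as \<open>Idt M \<zero> \<boxplus> f\<close>, which is
  strictly the same arrow.\<close>

lemma unit_into_sum_natural:
  assumes x: "x \<in> Obj M" and f: "f \<in> Hom M y z"
  shows "(init_arr M x \<boxplus> Idt M z) \<cdot> f = (Idt M x \<boxplus> f) \<cdot> (init_arr M x \<boxplus> Idt M y)"
proof -
  note y = Hom_Obj(1)[OF f] and z = Hom_Obj(2)[OF f] and i = init_arr_Hom[OF x]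
  have "(init_arr M x \<boxplus> Idt M z) \<cdot> (Idt M \<zero> \<boxplus> f) = init_arr M x \<boxplus> f"
    using ASum_Comp[OF Idt_Hom[OF Unit_Obj] i f Idt_Hom[OF z]] Comp_Idt_right[OF i]
      Comp_Idt_left[OF f] by simp
  also have "\<dots> = (Idt M x \<boxplus> f) \<cdot> (init_arr M x \<boxplus> Idt M y)"
    using ASum_Comp[OF i Idt_Hom[OF x] Idt_Hom[OF y] f] Comp_Idt_left[OF i] Comp_Idt_right[OF f]
    by simp
  finally show ?thesis
    using ASum_Unit_left f by (simp add: Hom_def)
qed

end

section \<open>Difference functors and crossed effects\<close>

locale functors_on_mon_ini = M: mon_ini M + A: functors_to_abelian M A
  for M :: "('o, 'a, 'r) smc_scheme" (structure) and A :: "('p, 'b, 's) cat_scheme"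
begin

section \<open>The shift transformation and its cokernel\<close>

lemma shift_ftor_functor:
  assumes F: "is_functor M A F" and x: "x \<in> Obj M"
  shows "is_functor M A (shift_ftor M x F)"
proof -
  have Hom: "Idt M x \<boxplus> f \<in> Hom M (x \<oplus> y) (x \<oplus> z)" if "f \<in> Hom M y z" for f y z
    using M.ASum_Hom[OF M.Idt_Hom[OF x] that] .
  show ?thesis
    unfolding is_functor_def
  proof (intro conjI ballI impI)
    show "fobj (shift_ftor M x F) \<in> extensional (Obj M)"
      "farr (shift_ftor M x F) \<in> extensional (Arr M)"
      by (simp_all add: shift_ftor_def)
    show "fobj (shift_ftor M x F) y \<in> Obj A" if "y \<in> Obj M" for y
      using that functor_Obj[OF F M.OSum_Obj[OF x that]] by (simp add: shift_ftor_def)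
    show "farr (shift_ftor M x F) f \<in>
        Hom A (fobj (shift_ftor M x F) (Dom M f)) (fobj (shift_ftor M x F) (Cod M f))"
      if "f \<in> Arr M" for f
      using functor_Hom[OF F Hom[OF HomI[OF that refl refl]]] M.Dom_Obj M.Cod_Obj that
      by (simp add: shift_ftor_def)
    show "farr (shift_ftor M x F) (Idt M y) = Idt A (fobj (shift_ftor M x F) y)"
      if "y \<in> Obj M" for y
      using functor_Idt[OF F M.OSum_Obj[OF x that]] M.ASum_Idt[OF x that] that
        Hom_Arr[OF M.Idt_Hom[OF that]] by (simp add: shift_ftor_def)
    fix f g assume fg: "f \<in> Arr M" "g \<in> Arr M" "Cod M f = Dom M g"
    then have f: "f \<in> Hom M (Dom M f) (Cod M f)" and g: "g \<in> Hom M (Cod M f) (Cod M g)"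
      by (auto simp: Hom_def)
    have "Idt M x \<boxplus> (g \<cdot> f) = (Idt M x \<boxplus> g) \<cdot> (Idt M x \<boxplus> f)"
      using M.ASum_Comp[OF M.Idt_Hom[OF x] M.Idt_Hom[OF x] f g]
        M.Comp_Idt_left[OF M.Idt_Hom[OF x]] by simp
    then show "farr (shift_ftor M x F) (g \<cdot> f) =
        farr (shift_ftor M x F) g \<cdot>\<^bsub>A\<^esub> farr (shift_ftor M x F) f"
      using functor_Comp[OF F Hom[OF f] Hom[OF g]] fg Hom_Arr[OF M.Comp_Hom[OF f g]]
      by (simp add: shift_ftor_def)
  qed
qed

lemma shift_ntrans_Hom:
  assumes F: "is_functor M A F" and x: "x \<in> Obj M"
  shows "shift_ntrans M x F \<in> Hom (Fct M A) F (shift_ftor M x F)"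
  unfolding shift_ntrans_def
proof (rule A.ntransI[OF F shift_ftor_functor[OF F x]])
  show "farr F (init_arr M x \<boxplus> Idt M y) \<in> Hom A (fobj F y) (fobj (shift_ftor M x F) y)"
    if "y \<in> Obj M" for y
    using functor_Hom[OF F M.unit_into_sum_Hom[OF x that]] that by (simp add: shift_ftor_def)
  fix f y z assume f: "f \<in> Hom M y z" and y: "y \<in> Obj M" and z: "z \<in> Obj M"
  note Hom = M.ASum_Hom[OF M.Idt_Hom[OF x] f]
  show "farr F (init_arr M x \<boxplus> Idt M z) \<cdot>\<^bsub>A\<^esub> farr F f =
      farr (shift_ftor M x F) f \<cdot>\<^bsub>A\<^esub> farr F (init_arr M x \<boxplus> Idt M y)"
    using functor_Comp[OF F f M.unit_into_sum_Hom[OF x z]]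
      functor_Comp[OF F M.unit_into_sum_Hom[OF x y] Hom]
      M.unit_into_sum_natural[OF x f] Hom_Arr[OF f] by (simp add: shift_ftor_def)
qed

text \<open>The interface through which \<open>delta\<close> is used from here on: a cokernel at
  each object, and a naturality square expressing its action on \<open>f\<close> by that of
  \<open>F\<close> on \<open>Idt M x \<boxplus> f\<close>.\<close>

lemma delta_projection:
  assumes F: "is_functor M A F" and x: "x \<in> Obj M"
  obtains q where "is_functor M A (delta M A x F)"
    "\<And>y. y \<in> Obj M \<Longrightarrow> is_cokernel A (farr F (init_arr M x \<boxplus> Idt M y)) (q y)"
    "\<And>y. y \<in> Obj M \<Longrightarrow> q y \<in> Hom A (fobj F (x \<oplus> y)) (fobj (delta M A x F) y)"
    "\<And>f y z. f \<in> Hom M y z \<Longrightarrow>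
      q z \<cdot>\<^bsub>A\<^esub> farr F (Idt M x \<boxplus> f) = farr (delta M A x F) f \<cdot>\<^bsub>A\<^esub> q y"
proof -
  interpret FC: category "Fct M A"
    by (rule A.Fct_category)
  define q where "q = coker (Fct M A) (shift_ntrans M x F)"
  note t = shift_ntrans_Hom[OF F x]
  have q: "is_ntrans M A q" "nsrc q = shift_ftor M x F" "ntgt q = delta M A x F"
    using FC.cokernel_Hom[OF A.Fct_coker(1)[OF t] t] unfolding q_def delta_def
    by (simp_all add: Hom_def)
  note Q = ntransD[OF q(1), unfolded q(2,3)]
  show thesis
  proof (rule that[of "ncmp q"])
    show "is_cokernel A (farr F (init_arr M x \<boxplus> Idt M y)) (ncmp q y)" if "y \<in> Obj M" for y
      using A.Fct_coker(2)[OF t that] that unfolding q_def by (simp add: shift_ntrans_def)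
    show "ncmp q y \<in> Hom A (fobj F (x \<oplus> y)) (fobj (delta M A x F) y)" if "y \<in> Obj M" for y
      using Q(3)[OF that] that by (simp add: shift_ftor_def)
    show "ncmp q z \<cdot>\<^bsub>A\<^esub> farr F (Idt M x \<boxplus> f) = farr (delta M A x F) f \<cdot>\<^bsub>A\<^esub> ncmp q y"
      if "f \<in> Hom M y z" for f y z
      using Q(4)[OF that] Hom_Arr[OF that] by (simp add: shift_ftor_def)
  qed (rule Q(2))
qed

text \<open>The vanishing of the crossed effect at \<open>as\<close>, stated without direct sums and cokernels.\<close>

definition cr_vanishes :: "('o, 'a, 'p, 'b) ftor \<Rightarrow> 'o list \<Rightarrow> bool" where
  "cr_vanishes F as \<longleftrightarrow>
    (\<forall>w. \<forall>t\<in>Hom A (fobj F (osum_list M as)) w.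
      (\<forall>i<length as. is_zero_arrow A (t \<cdot>\<^bsub>A\<^esub> farr F (omit_arr M i as))) \<longrightarrow> is_zero_arrow A t)"

text \<open>An arrow out of a coproduct is zero as soon as all its composites with the injections
  are. So being killed by \<open>cr_map\<close> is being killed by each canonical map, and the
  criterion for a zero cokernel becomes \<open>cr_vanishes\<close>.\<close>

lemma cr_proj_zero_object_iff:
  assumes F: "is_functor M A F" and as: "set as \<subseteq> Obj M"
  shows "cr_proj M A F as \<in> Hom A (fobj F (osum_list M as)) (Cod A (cr_proj M A F as))"
    and "is_zero_object A (Cod A (cr_proj M A F as)) \<longleftrightarrow> cr_vanishes F as"
proof -
  define X where "X i = fobj F (osum_list M (omit i as))" for i
  obtain S s where Ss: "cr_source M A F as = (S, s)"
    by fastforce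
  have "X i \<in> Obj A" for i
    unfolding X_def
    by (rule functor_Obj[OF F M.osum_list_Obj[OF subset_trans[OF set_omit_subset as]]])
  then have "\<exists>p. case p of (S, s) \<Rightarrow> is_coproduct A {..<length as} X S s"
    using A.finite_coproduct_exists[of "length as" X] by auto
  then have S: "is_coproduct A {..<length as} X S s"
    using Ss unfolding cr_source_def X_def[symmetric]
    by (metis (mono_tags, lifting) case_prod_conv someI_ex)
  then have SObj: "S \<in> Obj A" and s: "\<And>i. i < length as \<Longrightarrow> s i \<in> Hom A (X i) S"
    and ex1: "\<And>T g. T \<in> Obj A \<Longrightarrow> (\<And>i. i < length as \<Longrightarrow> g i \<in> Hom A (X i) T) \<Longrightarrow>
      \<exists>!h. h \<in> Hom A S T \<and> (\<forall>i<length as. h \<cdot>\<^bsub>A\<^esub> s i = g i)"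
    unfolding is_coproduct_def by (simp_all add: Ball_def)
  define h where "h = cr_map M A F as"
  have omit: "farr F (omit_arr M i as) \<in> Hom A (X i) (fobj F (osum_list M as))"
    if "i < length as" for i
    unfolding X_def using functor_Hom[OF F M.omit_arr_Hom[OF as that]] .
  have "h \<in> Hom A S (fobj F (osum_list M as)) \<and>
      (\<forall>i<length as. h \<cdot>\<^bsub>A\<^esub> s i = farr F (omit_arr M i as))"
    unfolding h_def cr_map_def Ss fst_conv snd_conv
    by (rule theI'[OF ex1]) (use omit functor_Obj[OF F M.osum_list_Obj[OF as]] in auto)
  then have h: "h \<in> Hom A S (fobj F (osum_list M as))"
    and hs: "\<And>i. i < length as \<Longrightarrow> h \<cdot>\<^bsub>A\<^esub> s i = farr F (omit_arr M i as)"
    by auto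
  have q: "is_cokernel A h (cr_proj M A F as)"
    unfolding cr_proj_def h_def[symmetric] using A.coker_is_cokernel[OF h] .
  show "cr_proj M A F as \<in> Hom A (fobj F (osum_list M as)) (Cod A (cr_proj M A F as))"
    using A.cokernel_Hom[OF q h] .
  have "is_zero_arrow A (t \<cdot>\<^bsub>A\<^esub> h) \<longleftrightarrow>
      (\<forall>i<length as. is_zero_arrow A (t \<cdot>\<^bsub>A\<^esub> farr F (omit_arr M i as)))"
    if t: "t \<in> Hom A (fobj F (osum_list M as)) w" for t w
  proof -
    have th: "t \<cdot>\<^bsub>A\<^esub> h \<in> Hom A S w"
      using A.Comp_Hom[OF h t] .
    have eq: "(t \<cdot>\<^bsub>A\<^esub> h) \<cdot>\<^bsub>A\<^esub> s i = t \<cdot>\<^bsub>A\<^esub> farr F (omit_arr M i as)" if "i < length as" for i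
      using A.Comp_assoc[OF s[OF that] h t] hs[OF that] by simp
    have w: "w \<in> Obj A"
      using A.Hom_Obj(2)[OF t] .
    show ?thesis
    proof
      assume "is_zero_arrow A (t \<cdot>\<^bsub>A\<^esub> h)"
      then show "\<forall>i<length as. is_zero_arrow A (t \<cdot>\<^bsub>A\<^esub> farr F (omit_arr M i as))"
        using A.zero_arrow_comp_right[OF _ th s] eq by metis
    next
      assume zero: "\<forall>i<length as. is_zero_arrow A (t \<cdot>\<^bsub>A\<^esub> farr F (omit_arr M i as))"
      \<comment> \<open>The zero arrow \<open>e\<close> and \<open>t \<cdot> h\<close> have the same
        composites with all injections \<open>s i\<close>, so the uniqueness clause of the coproduct
        identifies them.\<close>
      obtain e where e: "e \<in> Hom A S w" "is_zero_arrow A e"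
        using A.zero_arrow_Hom_exists[OF SObj w] .
      have "e \<cdot>\<^bsub>A\<^esub> s i = t \<cdot>\<^bsub>A\<^esub> farr F (omit_arr M i as)" if i: "i < length as" for i
        using A.zero_arrow_unique[OF A.zero_arrow_comp_right[OF e(2,1) s[OF i]]
            A.Comp_Hom[OF s[OF i] e(1)] _ A.Comp_Hom[OF omit[OF i] t]] zero i by blast
      moreover have "\<exists>!k. k \<in> Hom A S w \<and>
          (\<forall>i<length as. k \<cdot>\<^bsub>A\<^esub> s i = t \<cdot>\<^bsub>A\<^esub> farr F (omit_arr M i as))"
        by (rule ex1[OF w A.Comp_Hom[OF omit t]])
      ultimately have "e = t \<cdot>\<^bsub>A\<^esub> h"
        using e(1) th eq by blast
      then show "is_zero_arrow A (t \<cdot>\<^bsub>A\<^esub> h)"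
        using e(2) by simp
    qed
  qed
  then show "is_zero_object A (Cod A (cr_proj M A F as)) \<longleftrightarrow> cr_vanishes F as"
    unfolding A.cokernel_zero_object_iff[OF q h] cr_vanishes_def by blast
qed

text \<open>A zero functor has zero values, which gives one direction. For the other, functoriality
  has to come first: when all values are zero objects, parallel arrows between them coincide, so the
  induced map is well defined and the functor laws hold automatically.\<close>

lemma crossed_effect_zero_iff:
  assumes F: "is_functor M A F"
  shows "is_zero_object (Fct (cat_power M m) A) (crossed_effect M A m F) \<longleftrightarrow>
    (\<forall>as. length as = m \<and> set as \<subseteq> Obj M \<longrightarrow> cr_vanishes F as)"
proof -
  let ?P = "cat_power M m" and ?cr = "crossed_effect M A m F"
  interpret P: category ?P
    by (rule M.category_cat_power)
  interpret FP: functors_to_abelian ?P A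
    by unfold_locales
  have cr_obj: "fobj ?cr as = Cod A (cr_proj M A F as)" if "as \<in> Obj ?P" for as
    using that by (simp add: crossed_effect_def)
  have zero_iff: "is_zero_object A (fobj ?cr as) \<longleftrightarrow> cr_vanishes F as" if "as \<in> Obj ?P" for as
    using that cr_proj_zero_object_iff(2)[OF F, of as] cr_obj[OF that] by simp
  have "is_functor ?P A ?cr" if "\<forall>as\<in>Obj ?P. cr_vanishes F as"
  proof -
    have zero: "is_zero_object A (fobj ?cr as)" if "as \<in> Obj ?P" for as
      using \<open>\<forall>as\<in>Obj ?P. cr_vanishes F as\<close> that zero_iff by blast
    note Obj = is_zero_object_Obj[OF zero]
    have eq: "u = v" if "u \<in> Hom A (fobj ?cr as) y" "v \<in> Hom A (fobj ?cr as) y" "as \<in> Obj ?P"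
      for u v as y
      using zero_object_from_ex1[OF zero[OF that(3)] A.Hom_Obj(2)[OF that(1)]] that by blast
    have Hom: "farr ?cr fs \<in> Hom A (fobj ?cr as) (fobj ?cr bs)" if fs: "fs \<in> Hom ?P as bs" for fs as bs
    proof -
      note as = P.Hom_Obj(1)[OF fs] and bs = P.Hom_Obj(2)[OF fs]
      have maps: "map (Dom M) fs = as" "map (Cod M) fs = bs" "fs \<in> Arr ?P"
        using fs by (auto simp: Hom_def)
      note p = cr_proj_zero_object_iff(1)[OF F, of as] and q = cr_proj_zero_object_iff(1)[OF F, of bs]
      have "farr F (asum_list M fs) \<in> Hom A (fobj F (osum_list M as)) (fobj F (osum_list M bs))"
        using functor_Hom[OF F M.asum_list_Hom] maps by auto
      then have r: "cr_proj M A F bs \<cdot>\<^bsub>A\<^esub> farr F (asum_list M fs) \<in>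
          Hom A (fobj F (osum_list M as)) (fobj ?cr bs)"
        using A.Comp_Hom q bs cr_obj[OF bs] by simp
      obtain u where u: "u \<in> Hom A (fobj ?cr as) (fobj ?cr bs)"
        using zero_object_from_ex1[OF zero[OF as] Obj[OF bs]] by blast
      have "u \<cdot>\<^bsub>A\<^esub> cr_proj M A F as \<in> Hom A (fobj F (osum_list M as)) (fobj ?cr bs)"
        using A.Comp_Hom[OF p] u as cr_obj[OF as] by simp
      then have "u \<cdot>\<^bsub>A\<^esub> cr_proj M A F as = cr_proj M A F bs \<cdot>\<^bsub>A\<^esub> farr F (asum_list M fs)"
        using zero_object_to_ex1[OF zero[OF bs] A.Hom_Obj(1)[OF r]] r by blast
      \<comment> \<open>Both the equation and uniqueness hold because source and target are zero
        objects; this is what gives the definite description in \<open>crossed_effect\<close> a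
        value.\<close>
      then have "\<exists>!u. u \<in> Hom A (fobj ?cr as) (fobj ?cr bs) \<and>
          u \<cdot>\<^bsub>A\<^esub> cr_proj M A F as = cr_proj M A F bs \<cdot>\<^bsub>A\<^esub> farr F (asum_list M fs)"
        using u eq as by blast
      moreover have "farr ?cr fs = (THE u. u \<in> Hom A (fobj ?cr as) (fobj ?cr bs) \<and>
          u \<cdot>\<^bsub>A\<^esub> cr_proj M A F as = cr_proj M A F bs \<cdot>\<^bsub>A\<^esub> farr F (asum_list M fs))"
        unfolding cr_obj[OF as] cr_obj[OF bs]
        using maps(3) by (simp add: crossed_effect_def Let_def maps(1,2) del: cat_power_simps)
      ultimately show ?thesis
        using theI'[of "\<lambda>u. u \<in> Hom A (fobj ?cr as) (fobj ?cr bs) \<and>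
          u \<cdot>\<^bsub>A\<^esub> cr_proj M A F as = cr_proj M A F bs \<cdot>\<^bsub>A\<^esub> farr F (asum_list M fs)"] by simp
    qed
    show ?thesis
      unfolding is_functor_def
    proof (intro conjI ballI impI)
      show "fobj ?cr \<in> extensional (Obj ?P)" "farr ?cr \<in> extensional (Arr ?P)"
        by (simp_all add: crossed_effect_def)
      show "fobj ?cr as \<in> Obj A" if "as \<in> Obj ?P" for as
        using Obj[OF that] .
      show "farr ?cr fs \<in> Hom A (fobj ?cr (Dom ?P fs)) (fobj ?cr (Cod ?P fs))" if "fs \<in> Arr ?P" for fs
        by (rule Hom[OF HomI[OF that refl refl]])
      show "farr ?cr (Idt ?P as) = Idt A (fobj ?cr as)" if "as \<in> Obj ?P" for as
        by (rule eq[OF Hom[OF P.Idt_Hom[OF that]] A.Idt_Hom[OF Obj[OF that]] that])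
      fix fs gs assume fg: "fs \<in> Arr ?P" "gs \<in> Arr ?P" "Cod ?P fs = Dom ?P gs"
      have f: "fs \<in> Hom ?P (Dom ?P fs) (Cod ?P fs)" and g: "gs \<in> Hom ?P (Cod ?P fs) (Cod ?P gs)"
        using fg by (simp_all only: HomI)
      show "farr ?cr (gs \<cdot>\<^bsub>?P\<^esub> fs) = farr ?cr gs \<cdot>\<^bsub>A\<^esub> farr ?cr fs"
        by (rule eq[OF Hom[OF P.Comp_Hom[OF f g]] A.Comp_Hom[OF Hom[OF f] Hom[OF g]] P.Hom_Obj(1)[OF f]])
    qed
  qed
  then have "is_zero_object (Fct ?P A) ?cr \<longleftrightarrow> (\<forall>as\<in>Obj ?P. cr_vanishes F as)"
    unfolding FP.Fct_zero_object_iff using zero_iff by blast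
  then show ?thesis
    by auto
qed

text \<open>The cokernel defining the crossed effect is computed in two stages, the first of which divides
  out the summand omitting \<open>x\<close>.\<close>

lemma cr_vanishes_delta_iff:
  assumes F: "is_functor M A F" and x: "x \<in> Obj M" and as: "set as \<subseteq> Obj M"
  shows "cr_vanishes (delta M A x F) as \<longleftrightarrow> cr_vanishes F (x # as)"
proof -
  let ?D = "delta M A x F" and ?y = "osum_list M as"
  obtain q where D: "is_functor M A ?D"
    and coker: "\<And>y. y \<in> Obj M \<Longrightarrow> is_cokernel A (farr F (init_arr M x \<boxplus> Idt M y)) (q y)"
    and q: "\<And>y. y \<in> Obj M \<Longrightarrow> q y \<in> Hom A (fobj F (x \<oplus> y)) (fobj ?D y)"
    and nat: "\<And>f y z. f \<in> Hom M y z \<Longrightarrow> q z \<cdot>\<^bsub>A\<^esub> farr F (Idt M x \<boxplus> f) = farr ?D f \<cdot>\<^bsub>A\<^esub> q y"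
    using delta_projection[OF F x] by metis
  note y = M.osum_list_Obj[OF as]
  note init = functor_Hom[OF F M.unit_into_sum_Hom[OF x]]
  \<comment> \<open>Omitting position \<open>Suc i\<close> from \<open>x # as\<close> leaves
    \<open>x\<close> alone, so naturality of \<open>q\<close> moves the canonical map across the
    projection; the projection at the shorter sum reflects zero.\<close>
  have step: "is_zero_arrow A ((t \<cdot>\<^bsub>A\<^esub> q ?y) \<cdot>\<^bsub>A\<^esub> farr F (omit_arr M (Suc i) (x # as))) \<longleftrightarrow>
      is_zero_arrow A (t \<cdot>\<^bsub>A\<^esub> farr ?D (omit_arr M i as))"
    if t: "t \<in> Hom A (fobj ?D ?y) w" and i: "i < length as" for t w i
  proof -
    let ?z = "osum_list M (omit i as)" and ?f = "omit_arr M i as"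
    note f = M.omit_arr_Hom[OF as i]
    note z = M.Hom_Obj(1)[OF f]
    note xf = functor_Hom[OF F M.ASum_Hom[OF M.Idt_Hom[OF x] f]]
    note Df = functor_Hom[OF D f]
    have "(t \<cdot>\<^bsub>A\<^esub> q ?y) \<cdot>\<^bsub>A\<^esub> farr F (Idt M x \<boxplus> ?f) = (t \<cdot>\<^bsub>A\<^esub> farr ?D ?f) \<cdot>\<^bsub>A\<^esub> q ?z"
      using A.Comp_assoc[OF xf q[OF y] t] A.Comp_assoc[OF q[OF z] Df t] nat[OF f] by simp
    moreover have "is_zero_arrow A ((t \<cdot>\<^bsub>A\<^esub> farr ?D ?f) \<cdot>\<^bsub>A\<^esub> q ?z) \<longleftrightarrow>
        is_zero_arrow A (t \<cdot>\<^bsub>A\<^esub> farr ?D ?f)"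
      using A.cokernel_reflects_zero[OF coker[OF z] init[OF z]] A.Comp_Hom[OF Df t]
        A.zero_arrow_comp_right[OF _ A.Comp_Hom[OF Df t] q[OF z]] Hom_Cod[OF q[OF z]] by auto
    ultimately show ?thesis
      by (simp add: M.omit_arr_Cons_Suc)
  qed
  show ?thesis
  proof
    assume D_van: "cr_vanishes ?D as"
    show "cr_vanishes F (x # as)"
      unfolding cr_vanishes_def M.osum_list_Cons
    proof (intro allI ballI impI)
      fix w t assume t: "t \<in> Hom A (fobj F (x \<oplus> ?y)) w"
        and zero: "\<forall>i<length (x # as). is_zero_arrow A (t \<cdot>\<^bsub>A\<^esub> farr F (omit_arr M i (x # as)))"
      \<comment> \<open>Position 0 is the one that omits \<open>x\<close>; its canonical map is the
        one whose cokernel is \<open>q\<close>, so \<open>t\<close> descends to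
        \<open>u\<close>.\<close>
      have "is_zero_arrow A (t \<cdot>\<^bsub>A\<^esub> farr F (init_arr M x \<boxplus> Idt M ?y))"
        using zero[rule_format, of 0] by (simp add: M.omit_arr_Cons_0[OF as])
      then obtain u where u: "u \<in> Hom A (fobj ?D ?y) w" and t_eq: "u \<cdot>\<^bsub>A\<^esub> q ?y = t"
        using A.cokernel_ex1[OF coker[OF y] init[OF y] t] Hom_Cod[OF q[OF y]] by metis
      have "is_zero_arrow A (u \<cdot>\<^bsub>A\<^esub> farr ?D (omit_arr M i as))" if "i < length as" for i
        using zero[rule_format, of "Suc i"] step[OF u that] that by (simp add: t_eq)
      then have "is_zero_arrow A u"
        using D_van u unfolding cr_vanishes_def by blast
      then show "is_zero_arrow A t"
        using A.zero_arrow_comp_right[OF _ u q[OF y]] t_eq by simp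
    qed
  next
    assume F_van: "cr_vanishes F (x # as)"
    show "cr_vanishes ?D as"
      unfolding cr_vanishes_def
    proof (intro allI ballI impI)
      fix w t assume t: "t \<in> Hom A (fobj ?D ?y) w"
        and zero: "\<forall>i<length as. is_zero_arrow A (t \<cdot>\<^bsub>A\<^esub> farr ?D (omit_arr M i as))"
      have tq: "t \<cdot>\<^bsub>A\<^esub> q ?y \<in> Hom A (fobj F (x \<oplus> ?y)) w"
        using A.Comp_Hom[OF q[OF y] t] .
      have "is_zero_arrow A ((t \<cdot>\<^bsub>A\<^esub> q ?y) \<cdot>\<^bsub>A\<^esub> farr F (omit_arr M i (x # as)))"
        if "i < length (x # as)" for i
      proof (cases i)
        case 0
        then show ?thesis
          using A.zero_arrow_comp_left[OF A.cokernel_zero[OF coker[OF y] init[OF y]]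
              A.Comp_Hom[OF init[OF y] q[OF y]] t] A.Comp_assoc[OF init[OF y] q[OF y] t]
          by (simp add: y M.omit_arr_Cons_0[OF as])
      next
        case (Suc j)
        then show ?thesis
          using step[OF t] zero that by simp
      qed
      then have "is_zero_arrow A (t \<cdot>\<^bsub>A\<^esub> q ?y)"
        using F_van tq unfolding cr_vanishes_def M.osum_list_Cons by blast
      then show "is_zero_arrow A t"
        using A.cokernel_reflects_zero[OF coker[OF y] init[OF y]] t Hom_Cod[OF q[OF y]] y by simp
    qed
  qed
qed

section \<open>The base case, then the induction on the degree\<close>

lemma delta_zero_iff:
  assumes F: "is_functor M A F" and x: "x \<in> Obj M"
  shows "is_zero_object (Fct M A) (delta M A x F) \<longleftrightarrow>
    (\<forall>y\<in>Obj M. \<forall>w. \<forall>t\<in>Hom A (fobj F (x \<oplus> y)) w.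
      is_zero_arrow A (t \<cdot>\<^bsub>A\<^esub> farr F (init_arr M x \<boxplus> Idt M y)) \<longrightarrow> is_zero_arrow A t)"
proof -
  obtain q where D: "is_functor M A (delta M A x F)"
    and coker: "\<And>y. y \<in> Obj M \<Longrightarrow> is_cokernel A (farr F (init_arr M x \<boxplus> Idt M y)) (q y)"
    and q: "\<And>y. y \<in> Obj M \<Longrightarrow> q y \<in> Hom A (fobj F (x \<oplus> y)) (fobj (delta M A x F) y)"
    using delta_projection[OF F x] by metis
  have "is_zero_object A (fobj (delta M A x F) y) \<longleftrightarrow> (\<forall>w. \<forall>t\<in>Hom A (fobj F (x \<oplus> y)) w.
      is_zero_arrow A (t \<cdot>\<^bsub>A\<^esub> farr F (init_arr M x \<boxplus> Idt M y)) \<longrightarrow> is_zero_arrow A t)"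
    if y: "y \<in> Obj M" for y
    using A.cokernel_zero_object_iff[OF coker[OF y] functor_Hom[OF F M.unit_into_sum_Hom[OF x y]]]
      Hom_Cod[OF q[OF y]] by simp
  then show ?thesis
    unfolding A.Fct_zero_object_iff using D by simp
qed

lemma cr_vanishes_singleton_iff:
  assumes "x \<in> Obj M"
  shows "cr_vanishes F [x] \<longleftrightarrow> (\<forall>w. \<forall>t\<in>Hom A (fobj F x) w.
    is_zero_arrow A (t \<cdot>\<^bsub>A\<^esub> farr F (init_arr M x)) \<longrightarrow> is_zero_arrow A t)"
  using M.ASum_Unit_right[OF Hom_Arr[OF M.init_arr_Hom[OF assms]]]
  by (simp add: cr_vanishes_def M.OSum_Unit_right assms M.omit_arr_Cons_0)

text \<open>The quantifier over \<open>x\<close> belongs to each side separately: from left to right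
  \<open>y = \<zero>\<close> suffices for the same \<open>x\<close>, but from right to left the
  vanishing at all sums \<open>x \<oplus> y\<close> is used to treat one \<open>x\<close>.\<close>

lemma all_delta_zero_iff:
  assumes F: "is_functor M A F"
  shows "(\<forall>x\<in>Obj M. is_zero_object (Fct M A) (delta M A x F)) \<longleftrightarrow>
    (\<forall>x\<in>Obj M. cr_vanishes F [x])"
proof (intro iffI ballI)
  fix x assume x: "x \<in> Obj M" and "\<forall>x\<in>Obj M. is_zero_object (Fct M A) (delta M A x F)"
  then have "\<forall>w. \<forall>t\<in>Hom A (fobj F (x \<oplus> \<zero>)) w.
      is_zero_arrow A (t \<cdot>\<^bsub>A\<^esub> farr F (init_arr M x \<boxplus> Idt M \<zero>)) \<longrightarrow> is_zero_arrow A t"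
    using delta_zero_iff[OF F x] M.Unit_Obj by blast
  then show "cr_vanishes F [x]"
    unfolding cr_vanishes_singleton_iff[OF x] M.OSum_Unit_right[OF x]
      M.ASum_Unit_right[OF Hom_Arr[OF M.init_arr_Hom[OF x]]] .
next
  fix x assume x: "x \<in> Obj M" and van: "\<forall>x\<in>Obj M. cr_vanishes F [x]"
  show "is_zero_object (Fct M A) (delta M A x F)"
    unfolding delta_zero_iff[OF F x]
  proof (intro ballI allI impI)
    fix y w t assume y: "y \<in> Obj M" and t: "t \<in> Hom A (fobj F (x \<oplus> y)) w"
      and zero: "is_zero_arrow A (t \<cdot>\<^bsub>A\<^esub> farr F (init_arr M x \<boxplus> Idt M y))"
    note f = functor_Hom[OF F M.unit_into_sum_Hom[OF x y]]
      and g = functor_Hom[OF F M.init_arr_Hom[OF y]]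
    have "is_zero_arrow A (t \<cdot>\<^bsub>A\<^esub> farr F (init_arr M (x \<oplus> y)))"
      using A.zero_arrow_comp_right[OF zero A.Comp_Hom[OF f t] g] A.Comp_assoc[OF g f t]
        functor_Comp[OF F M.init_arr_Hom[OF y] M.unit_into_sum_Hom[OF x y]]
        M.init_arr_OSum[OF x y] by simp
    then show "is_zero_arrow A t"
      using van M.OSum_Obj[OF x y] cr_vanishes_singleton_iff t by blast
  qed
qed

lemma Pol_fort_iff_cr_vanishes:
  "is_functor M A F \<Longrightarrow> F \<in> Pol_fort M A (int d) \<longleftrightarrow>
    (\<forall>as. length as = Suc d \<and> set as \<subseteq> Obj M \<longrightarrow> cr_vanishes F as)"
proof (induction d arbitrary: F)
  case 0
  \<comment> \<open>Unfolded at 0 and at -1: degree 0 asks for differences of degree -1, that is,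
    for zero functors.\<close>
  have "F \<in> Pol_fort M A (int 0) \<longleftrightarrow>
      (\<forall>x\<in>Obj M. is_zero_object (Fct M A) (delta M A x F))"
    using 0 by (simp add: Pol_fort.simps[of M A 0] Pol_fort.simps[of M A "-1"])
  then show ?case
    unfolding all_delta_zero_iff[OF 0] by (auto simp: length_Suc_conv)
next
  case (Suc d)
  have "F \<in> Pol_fort M A (int (Suc d)) \<longleftrightarrow> (\<forall>x\<in>Obj M. delta M A x F \<in> Pol_fort M A (int d))"
    using Suc.prems by (subst Pol_fort.simps) simp
  \<comment> \<open>The induction hypothesis is applied to \<open>delta M A x F\<close>, a functor
    by \<open>delta_projection\<close>; hence the induction is over arbitrary
    \<open>F\<close>.\<close>
  also have "\<dots> \<longleftrightarrow> (\<forall>x\<in>Obj M. \<forall>as. length as = Suc d \<and> set as \<subseteq> Obj M \<longrightarrow>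
      cr_vanishes (delta M A x F) as)"
    using Suc.IH delta_projection[OF Suc.prems] by metis
  also have "\<dots> \<longleftrightarrow> (\<forall>x\<in>Obj M. \<forall>as. length as = Suc d \<and> set as \<subseteq> Obj M \<longrightarrow>
      cr_vanishes F (x # as))"
    using cr_vanishes_delta_iff[OF Suc.prems] by blast
  also have "\<dots> \<longleftrightarrow> (\<forall>as. length as = Suc (Suc d) \<and> set as \<subseteq> Obj M \<longrightarrow> cr_vanishes F as)"
    by (subst length_Suc_conv) (auto 0 3)
  finally show ?case .
qed

end

theorem proposition2p3:
  fixes M :: "('o, 'a) smc" and A :: "('p, 'b) cat"
    and F :: "('o, 'a, 'p, 'b) ftor" and d :: nat
  assumes "mon_ini M" and "abelian_category A" and "is_functor M A F"
  shows "F \<in> Pol_fort M A (int d) \<longleftrightarrow>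
    is_zero_object (Fct (cat_power M (d + 1)) A) (crossed_effect M A (d + 1) F)"
proof -
  interpret mon_ini M by fact
  interpret functors_on_mon_ini M A
    by (intro functors_on_mon_ini.intro functors_to_abelian.intro assms(1,2)) unfold_locales
  show ?thesis
    using Pol_fort_iff_cr_vanishes[OF assms(3)] crossed_effect_zero_iff[OF assms(3)] by simp
qed

end
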